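(* Let $x\in\mathbb{R}^N$, $\eta_x>0$, and let $\phi:\mathbb{R}^N\to\mathbb{R}$ satisfy hypothesis (H) at $x$ with radius $\eta_x$, and assume $p_x\neq0$. Then for every $\epsilon\in(0,\eta_x)$ with $\epsilon|\nabla^2\phi(x)|\le|p_x|$: $$\Big|\mathcal{A}_\epsilon\phi(x)-\phi(x)-\frac{1}{c_s}\epsilon^{2s}\mathcal{L}_s[\phi](x)\Big|\le 2\epsilon^{2s}\Big(2sC_x\big(\eta_x^{2-2s}-\epsilon^{2-2s}\big)A_\epsilon+\Big(\frac{\eta_x^{-2s}}{2}+\frac{s\,\eta_x^{1-2s}}{2s-1}\Big)(1-s)\,\omega_\phi(A_\epsilon)\Big)+2s\epsilon^3\frac{|\nabla^2\phi(x)|^2}{|p_x|}+s\epsilon^2\sup_{y\in B_\epsilon(x)}|\nabla^2\phi(y)-\nabla^2\phi(x)|.$$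
   Context: Fix $N\ge1$ and $s\in(\frac12,1)$. Let $C_s=\frac{4^s s\,\Gamma(\frac12+s)}{\pi^{1/2}\Gamma(1-s)}$ and $c_s=\frac{C_s}{s(1-s)}$. Let $\mu_s$ be the Borel measure on $(0,\infty)$ with $\mathrm{d}\mu_s(t)=C_s t^{-1-2s}\,\mathrm{d}t$, and write $\fint_\epsilon^\infty g\,\mathrm{d}\mu_s=\frac{1}{\mu_s((\epsilon,\infty))}\int_\epsilon^\infty g\,\mathrm{d}\mu_s$. For $\phi:\mathbb{R}^N\to\mathbb{R}$ and $x,y,\tilde y\in\mathbb{R}^N$ let $L_\phi(x,y,\tilde y)=\phi(x+y)+\phi(x-\tilde y)-2\phi(x)$. Define $$\mathcal{L}_s[\phi](x)=\sup_{|y|=1}\inf_{|\tilde y|=1}\int_0^\infty L_\phi(x,ty,t\tilde y)\,\mathrm{d}\mu_s(t),$$ where $\int_0^\infty$ means $\lim_{\delta\to0^+}\int_\delta^\infty$ (a value in $[-\infty,\infty]$). Define $$\mathcal{A}_\epsilon^o\phi(x)=\frac12\Big(\sup_{|y|=1}\fint_\epsilon^\infty\phi(x+ty)\,\mathrm{d}\mu_s(t)+\inf_{|y|=1}\fint_\epsilon^\infty\phi(x+ty)\,\mathrm{d}\mu_s(t)\Big),\qquad \mathcal{A}_\epsilon\phi(x)=(1-s)\mathcal{A}_\epsilon^o\phi(x)+\frac{s}{2}\Big(\sup_{B_\epsilon(x)}\phi+\inf_{B_\epsilon(x)}\phi\Big).$$ Hypothesis (H) at $x$ with radius $\eta_x>0$: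 $\phi:\mathbb{R}^N\to\mathbb{R}$ is bounded and Borel; (i) $\phi\in C^2(\bar B_{\eta_x}(x))$, and we set $p_x=\nabla\phi(x)$, $C_x=\frac12\|\nabla^2\phi\|_{L^\infty(B_{\eta_x}(x))}$; (ii) $\phi$ is bounded and uniformly continuous on $\mathbb{R}^N\setminus\bar B_{\eta_x}(x)$, with modulus $\omega_\phi(a)=\sup\{|\phi(z)-\phi(w)|: z,w\in\mathbb{R}^N\setminus\bar B_{\eta_x}(x),\ |z-w|\le a\}$. $|\nabla^2\phi(\cdot)|$ denotes the operator norm of the Hessian. When $p_x\ne0$ and $0<\epsilon<\eta_x$ define $$\kappa_\epsilon=\sup\Big\{a\in[0,2]:\ a^2\le\frac{8\omega_\phi(a)}{|p_x|}\cdot\frac{\frac{2s-1}{2s}\eta_x^{-2s}+\eta_x^{1-2s}}{\epsilon^{1-2s}-\eta_x^{1-2s}}\Big\},\quad A_\epsilon=\max\Big\{\frac{16C_x}{|p_x|}\cdot\frac{2s-1}{1-s}\cdot\frac{\eta_x^{2-2s}-\epsilon^{2-2s}}{\epsilon^{1-2s}-\eta_x^{1-2s}},\ \kappa_\epsilon\Big\}.$$ *)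

theory Defs
  imports "HOL-Analysis.Analysis"
begin

definition Cs :: "real \<Rightarrow> real" where
  "Cs s = 4 powr s * s * Gamma (1/2 + s) / (sqrt pi * Gamma (1 - s))"

definition cs :: "real \<Rightarrow> real" where
  "cs s = Cs s / (s * (1 - s))"

definition mus :: "real \<Rightarrow> real measure" where
  "mus s = density lborel (\<lambda>t. ennreal (if 0 < t then Cs s * (t powr (- 1 - 2 * s)) else 0))"

definition tail_int :: "real \<Rightarrow> real \<Rightarrow> (real \<Rightarrow> real) \<Rightarrow> real" where
  "tail_int s \<delta> g = (LINT t:{\<delta><..}|mus s. g t)"

definition tail_avg :: "real \<Rightarrow> real \<Rightarrow> (real \<Rightarrow> real) \<Rightarrow> real" where
  "tail_avg s \<epsilon> g = tail_int s \<epsilon> g / measure (mus s) {\<epsilon><..}"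

definition Lphi :: "('a::real_normed_vector \<Rightarrow> real) \<Rightarrow> 'a \<Rightarrow> 'a \<Rightarrow> 'a \<Rightarrow> real" where
  "Lphi \<phi> x y y' = \<phi> (x + y) + \<phi> (x - y') - 2 * \<phi> x"

text \<open>The operator L_s, with the improper integral at 0 taken as a limit in the extended reals.\<close>
definition Ls :: "real \<Rightarrow> ('a::real_normed_vector \<Rightarrow> real) \<Rightarrow> 'a \<Rightarrow> ereal" where
  "Ls s \<phi> x = (SUP y\<in>sphere 0 1. INF y'\<in>sphere 0 1.
      Lim (at_right 0) (\<lambda>\<delta>. ereal (tail_int s \<delta> (\<lambda>t. Lphi \<phi> x (t *\<^sub>R y) (t *\<^sub>R y')))))"

definition Ao :: "real \<Rightarrow> real \<Rightarrow> ('a::real_normed_vector \<Rightarrow> real) \<Rightarrow> 'a \<Rightarrow> real" where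
  "Ao s \<epsilon> \<phi> x = (1/2) * ((SUP y\<in>sphere 0 1. tail_avg s \<epsilon> (\<lambda>t. \<phi> (x + t *\<^sub>R y)))
                        + (INF y\<in>sphere 0 1. tail_avg s \<epsilon> (\<lambda>t. \<phi> (x + t *\<^sub>R y))))"

definition Aeps :: "real \<Rightarrow> real \<Rightarrow> ('a::real_normed_vector \<Rightarrow> real) \<Rightarrow> 'a \<Rightarrow> real" where
  "Aeps s \<epsilon> \<phi> x = (1 - s) * Ao s \<epsilon> \<phi> x
      + (s / 2) * ((SUP z\<in>ball x \<epsilon>. \<phi> z) + (INF z\<in>ball x \<epsilon>. \<phi> z))"

definition omega :: "('a::real_normed_vector \<Rightarrow> real) \<Rightarrow> 'a \<Rightarrow> real \<Rightarrow> real \<Rightarrow> real" where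
  "omega \<phi> x \<eta> a = (SUP zw\<in>{(z, w). z \<notin> cball x \<eta> \<and> w \<notin> cball x \<eta> \<and> dist z w \<le> a}.
      \<bar>\<phi> (fst zw) - \<phi> (snd zw)\<bar>)"

text \<open>kappa_epsilon; here p stands for the norm of p_x and w for the modulus omega_phi.\<close>
definition kappa :: "real \<Rightarrow> (real \<Rightarrow> real) \<Rightarrow> real \<Rightarrow> real \<Rightarrow> real \<Rightarrow> real" where
  "kappa s w p \<eta> \<epsilon> = Sup {a\<in>{0..2}. a\<^sup>2 \<le> 8 * w a / p *
      (((2 * s - 1) / (2 * s) * \<eta> powr (- 2 * s) + \<eta> powr (1 - 2 * s)) / (\<epsilon> powr (1 - 2 * s) - \<eta> powr (1 - 2 * s)))}"

definition Acoef :: "real \<Rightarrow> real \<Rightarrow> (real \<Rightarrow> real) \<Rightarrow> real \<Rightarrow> real \<Rightarrow> real \<Rightarrow> real" where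
  "Acoef s Cx w p \<eta> \<epsilon> = max
     (16 * Cx / p * ((2 * s - 1) / (1 - s)) * ((\<eta> powr (2 - 2 * s) - \<epsilon> powr (2 - 2 * s)) / (\<epsilon> powr (1 - 2 * s) - \<eta> powr (1 - 2 * s))))
     (kappa s w p \<eta> \<epsilon>)"

end

theory Submission
  imports Defs
begin

text \<open>
  Let \<open>e = \<nabla>\<phi>(x) / |\<nabla>\<phi>(x)|\<close>. Since \<open>s > 1/2\<close>, the integral defining \<open>\<L>\<^sub>s\<close> diverges at 0 unless the first
  order terms cancel, so the sup-inf equals its value at \<open>y = y' = e\<close>. The part of this integral over
  \<open>t > \<epsilon>\<close> corresponds to evaluating both averages in \<open>Ao\<close> at \<open>\<plusminus>e\<close>, and the part over \<open>t \<le> \<epsilon>\<close> is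
  \<open>\<epsilon>\<^sup>2 (H e \<bullet> e)\<close> up to a constant factor and a Taylor remainder, matching the sup and inf over the ball.

  If \<open>|y - e| = a\<close>, then in passing from direction \<open>e\<close> to \<open>y\<close> the gradient lowers the average by
  a multiple of \<open>|\<nabla>\<phi>(x)| a\<^sup>2\<close>, while the Hessian and the far field raise it by at most multiples of \<open>a\<close>
  and \<open>\<omega>(a)\<close>. The gradient wins if \<open>a > A\<close>; for \<open>a \<le> A\<close> the other two terms are the asserted error.
\<close>

subsection \<open>Integrals of powers\<close>

text \<open>The obstacle is the far field. With a = |y - e|, the points x + t y and x + t e are t a
  apart, while the bound may only use \<omega>(a), and only outside the ball of radius \<eta>. About
  2 t intermediate points are therefore inserted, at the cost of a factor that grows linearly in t.
  Such a factor is integrable at infinity against t^(-1-2s) because s > 1/2, and it produces the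
  term s \<eta>^(1-2s) / (2s-1) of the bound. The intermediate points need a second dimension. In
  dimension one the sphere is {e, -e} and no directions have to be compared.

  The constants 16 and 8 in \<open>Acoef\<close> and \<open>kappa\<close> leave each of the two
  losses only a fixed fraction of the gain from the gradient.

  The weights 1 - s and s in \<open>Aeps\<close> and the constant c_s fit together so that the tail
  of the operator cancels identically against the averages at e and -e, and the part near 0 matches
  the ball term up to the oscillation of the Hessian. Infima are never estimated directly: they are
  suprema for -\<phi>.\<close>

lemma has_integral_nonneg_imp_set_integral:
  fixes f :: "real \<Rightarrow> real"
  assumes f: "f \<in> borel_measurable borel" and S: "S \<in> sets borel"
    and nonneg: "\<And>t. t \<in> S \<Longrightarrow> 0 \<le> f t" and r: "(f has_integral r) S"
  shows "set_integrable lborel S f" "(LINT t:S|lborel. f t) = r"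
proof -
  \<comment> \<open>Integrals of powers come as gauge integrals, whereas \<open>tail_int\<close> is
    a Lebesgue integral. For a nonnegative integrand the two agree through the nonnegative
    integral.\<close>
  have "has_bochner_integral lborel (\<lambda>t. indicator S t * f t) r"
  proof (rule has_bochner_integral_nn_integral)
    show "(\<lambda>t. indicator S t * f t) \<in> borel_measurable lborel"
      using f S by measurable
    show "AE t in lborel. 0 \<le> indicator S t * f t"
      using nonneg by (auto simp: indicator_def)
    show "0 \<le> r" using has_integral_nonneg[OF r nonneg] .
    show "(\<integral>\<^sup>+ t. ennreal (indicator S t * f t) \<partial>lborel) = ennreal r"
      using nn_integral_has_integral_lebesgue[OF nonneg r] by simp
  qed
  then show "set_integrable lborel S f" "(LINT t:S|lborel. f t) = r"
    by (auto simp: set_integrable_def set_lebesgue_integral_def has_bochner_integral_iff)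
qed

lemma set_integral_powr_Ioi:
  fixes a b :: real
  assumes "b < -1" "0 < a"
  shows "set_integrable lborel {a<..} (\<lambda>t. t powr b)"
    "(LINT t:{a<..}|lborel. t powr b) = a powr (b + 1) / (- b - 1)"
proof -
  have "((\<lambda>t. t powr b) has_integral (a powr (b + 1) / (- b - 1))) {a<..}"
  \<comment> \<open>Half-open intervals tile the ray \<open>{a<..}\<close> of
    \<open>tail_int\<close> without overlap, hence their use throughout; dropping an endpoint
    changes no integral.\<close>
  proof (rule has_integral_spike_set_eq[where S = "{a..}", THEN iffD1])
    show "((\<lambda>t. t powr b) has_integral a powr (b + 1) / (- b - 1)) {a..}"
      using has_integral_powr_to_inf[OF assms] assms
      by (simp add: minus_divide_left[symmetric] minus_divide_right)
    show "negligible {x \<in> {a..} - {a<..}. x powr b \<noteq> 0}"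
      by (rule negligible_subset[of "{a}"]) auto
    show "negligible {x \<in> {a<..} - {a..}. x powr b \<noteq> 0}"
      by (rule negligible_subset[of "{a}"]) auto
  qed
  from has_integral_nonneg_imp_set_integral[OF _ _ _ this]
  show "set_integrable lborel {a<..} (\<lambda>t. t powr b)"
    "(LINT t:{a<..}|lborel. t powr b) = a powr (b + 1) / (- b - 1)" by auto
qed

lemma set_integral_powr_Ioc_0:
  fixes b c :: real
  assumes "-1 < b" "0 \<le> c"
  shows "set_integrable lborel {0<..c} (\<lambda>t. t powr b)"
    "(LINT t:{0<..c}|lborel. t powr b) = c powr (b + 1) / (b + 1)"
proof -
  have "((\<lambda>t. t powr b) has_integral (c powr (b + 1) / (b + 1))) {0<..c}"
  proof (rule has_integral_spike_set_eq[where S = "{0..c}", THEN iffD1])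
    show "((\<lambda>t. t powr b) has_integral c powr (b + 1) / (b + 1)) {0..c}"
      using has_integral_powr_from_0[OF assms] .
    show "negligible {x \<in> {0..c} - {0<..c}. x powr b \<noteq> 0}"
      by (rule negligible_subset[of "{0}"]) auto
    show "negligible {x \<in> {0<..c} - {0..c}. x powr b \<noteq> 0}"
      by (rule negligible_subset[of "{0}"]) auto
  qed
  from has_integral_nonneg_imp_set_integral[OF _ _ _ this]
  show "set_integrable lborel {0<..c} (\<lambda>t. t powr b)"
    "(LINT t:{0<..c}|lborel. t powr b) = c powr (b + 1) / (b + 1)" by auto
qed

lemma set_integral_powr_Ioc:
  fixes a b c :: real
  assumes "b \<noteq> -1" "0 < a" "a \<le> c"
  shows "set_integrable lborel {a<..c} (\<lambda>t. t powr b)"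
    "(LINT t:{a<..c}|lborel. t powr b) = (c powr (b + 1) - a powr (b + 1)) / (b + 1)"
proof -
  have "((\<lambda>t. t powr b) has_integral ((c powr (b + 1) - a powr (b + 1)) / (b + 1))) {a<..c}"
  proof (rule has_integral_spike_set_eq[where S = "{a..c}", THEN iffD1])
    have "((\<lambda>t. t powr b) has_integral (c powr (b + 1) / (b + 1) - a powr (b + 1) / (b + 1))) {a..c}"
    proof (rule fundamental_theorem_of_calculus)
      fix t assume "t \<in> {a..c}"
      then show "((\<lambda>t. t powr (b + 1) / (b + 1)) has_vector_derivative t powr b) (at t within {a..c})"
        using assms unfolding has_real_derivative_iff_has_vector_derivative[symmetric]
        by (auto intro!: derivative_eq_intros)
    qed fact
    then show "((\<lambda>t. t powr b) has_integral ((c powr (b + 1) - a powr (b + 1)) / (b + 1))) {a..c}"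
      by (simp add: diff_divide_distrib)
    show "negligible {x \<in> {a..c} - {a<..c}. x powr b \<noteq> 0}"
      by (rule negligible_subset[of "{a}"]) auto
    show "negligible {x \<in> {a<..c} - {a..c}. x powr b \<noteq> 0}"
      by (rule negligible_subset[of "{a}"]) auto
  qed
  from has_integral_nonneg_imp_set_integral[OF _ _ _ this]
  show "set_integrable lborel {a<..c} (\<lambda>t. t powr b)"
    "(LINT t:{a<..c}|lborel. t powr b) = (c powr (b + 1) - a powr (b + 1)) / (b + 1)" by auto
qed

section \<open>The weight t^(-1-2s) and its moments\<close>

locale fractional_order =
  fixes s :: real
  assumes s_gt: "1/2 < s" and s_lt: "s < 1"
begin

text \<open>The density of \<open>mus s\<close> without the factor \<open>Cs s\<close>. In the
  averages that factor cancels against the mass of the tail, so it matters only where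
  \<open>Ls\<close> is evaluated.\<close>

definition W :: "real \<Rightarrow> real" where
  "W t = t powr (- 1 - 2 * s)"

lemma W_nonneg: "0 \<le> W t"
  by (simp add: W_def)

lemma W_measurable [measurable]: "W \<in> borel_measurable borel"
  unfolding W_def by measurable

lemma W_mult:
  assumes "0 < t"
  shows "W t * t = t powr (- 2 * s)" "W t * t\<^sup>2 = t powr (1 - 2 * s)"
proof -
  show "W t * t = t powr (- 2 * s)"
    using assms powr_mult_base[of t "-1 - 2 * s"] by (simp add: W_def mult.commute)
  have "W t * t\<^sup>2 = t powr (- 1 - 2 * s) * t powr 2"
    using assms by (simp add: W_def)
  also have "\<dots> = t powr (1 - 2 * s)"
    by (simp add: powr_add[symmetric])
  finally show "W t * t\<^sup>2 = t powr (1 - 2 * s)" .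
qed

lemma W_Ioi:
  assumes "0 < a"
  shows "set_integrable lborel {a<..} W" "(LINT t:{a<..}|lborel. W t) = a powr (- 2 * s) / (2 * s)"
  using set_integral_powr_Ioi[of "- 1 - 2 * s" a] assms s_gt by (simp_all add: W_def[abs_def])

lemma W_t_Ioi:
  assumes "0 < a"
  shows "set_integrable lborel {a<..} (\<lambda>t. W t * t)"
    "(LINT t:{a<..}|lborel. W t * t) = a powr (1 - 2 * s) / (2 * s - 1)"
proof -
  have 1: "set_integrable lborel {a<..} (\<lambda>t. W t * t) = set_integrable lborel {a<..} (\<lambda>t. t powr (- 2 * s))"
    using assms by (intro set_integrable_cong) (auto simp: W_mult)
  have 2: "(LINT t:{a<..}|lborel. W t * t) = (LINT t:{a<..}|lborel. t powr (- 2 * s))"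
    using assms by (intro set_lebesgue_integral_cong) (auto simp: W_mult)
  show "set_integrable lborel {a<..} (\<lambda>t. W t * t)"
    "(LINT t:{a<..}|lborel. W t * t) = a powr (1 - 2 * s) / (2 * s - 1)"
    unfolding 1 2 using set_integral_powr_Ioi[of "- 2 * s" a] assms s_gt by (simp_all add: algebra_simps)
qed

lemma W_t_Ioc:
  assumes "0 < a" "a \<le> c"
  shows "set_integrable lborel {a<..c} (\<lambda>t. W t * t)"
    "(LINT t:{a<..c}|lborel. W t * t) = (a powr (1 - 2 * s) - c powr (1 - 2 * s)) / (2 * s - 1)"
proof -
  have 1: "set_integrable lborel {a<..c} (\<lambda>t. W t * t) = set_integrable lborel {a<..c} (\<lambda>t. t powr (- 2 * s))"
    using assms by (intro set_integrable_cong) (auto simp: W_mult)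
  have 2: "(LINT t:{a<..c}|lborel. W t * t) = (LINT t:{a<..c}|lborel. t powr (- 2 * s))"
    using assms by (intro set_lebesgue_integral_cong) (auto simp: W_mult)
  have "(c powr (1 - 2 * s) - a powr (1 - 2 * s)) / (1 - 2 * s)
      = (a powr (1 - 2 * s) - c powr (1 - 2 * s)) / (2 * s - 1)"
    by (metis minus_diff_eq minus_divide_divide)
  then show "set_integrable lborel {a<..c} (\<lambda>t. W t * t)"
    "(LINT t:{a<..c}|lborel. W t * t) = (a powr (1 - 2 * s) - c powr (1 - 2 * s)) / (2 * s - 1)"
    unfolding 1 2 using set_integral_powr_Ioc[of "- 2 * s" a c] assms s_gt by simp_all
qed

lemma W_t2_Ioc:
  assumes "0 < a" "a \<le> c"
  shows "set_integrable lborel {a<..c} (\<lambda>t. W t * t\<^sup>2)"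
    "(LINT t:{a<..c}|lborel. W t * t\<^sup>2) = (c powr (2 - 2 * s) - a powr (2 - 2 * s)) / (2 - 2 * s)"
proof -
  have 1: "set_integrable lborel {a<..c} (\<lambda>t. W t * t\<^sup>2) = set_integrable lborel {a<..c} (\<lambda>t. t powr (1 - 2 * s))"
    using assms by (intro set_integrable_cong) (auto simp: W_mult)
  have 2: "(LINT t:{a<..c}|lborel. W t * t\<^sup>2) = (LINT t:{a<..c}|lborel. t powr (1 - 2 * s))"
    using assms by (intro set_lebesgue_integral_cong) (auto simp: W_mult)
  show "set_integrable lborel {a<..c} (\<lambda>t. W t * t\<^sup>2)"
    "(LINT t:{a<..c}|lborel. W t * t\<^sup>2) = (c powr (2 - 2 * s) - a powr (2 - 2 * s)) / (2 - 2 * s)"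
    unfolding 1 2 using set_integral_powr_Ioc[of "1 - 2 * s" a c] assms s_lt by simp_all
qed

lemma W_t2_Ioc_0:
  assumes "0 < c"
  shows "set_integrable lborel {0<..c} (\<lambda>t. W t * t\<^sup>2)"
    "(LINT t:{0<..c}|lborel. W t * t\<^sup>2) = c powr (2 - 2 * s) / (2 - 2 * s)"
proof -
  have 1: "set_integrable lborel {0<..c} (\<lambda>t. W t * t\<^sup>2) = set_integrable lborel {0<..c} (\<lambda>t. t powr (1 - 2 * s))"
    by (intro set_integrable_cong) (auto simp: W_mult)
  have 2: "(LINT t:{0<..c}|lborel. W t * t\<^sup>2) = (LINT t:{0<..c}|lborel. t powr (1 - 2 * s))"
    by (intro set_lebesgue_integral_cong) (auto simp: W_mult)
  show "set_integrable lborel {0<..c} (\<lambda>t. W t * t\<^sup>2)"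
    "(LINT t:{0<..c}|lborel. W t * t\<^sup>2) = c powr (2 - 2 * s) / (2 - 2 * s)"
    unfolding 1 2 using set_integral_powr_Ioc_0[of "1 - 2 * s" c] assms s_lt by simp_all
qed

lemma Cs_pos: "0 < Cs s"
  using s_gt s_lt unfolding Cs_def by (intro divide_pos_pos mult_pos_pos Gamma_real_pos) auto

lemma tail_int_eq:
  assumes [measurable]: "g \<in> borel_measurable borel" and \<delta>: "0 \<le> \<delta>"
  shows "tail_int s \<delta> g = Cs s * (LINT t:{\<delta><..}|lborel. W t * g t)"
proof -
  have "tail_int s \<delta> g = (LINT t|lborel. (if 0 < t then Cs s * t powr (- 1 - 2 * s) else 0)
      *\<^sub>R (indicator {\<delta><..} t *\<^sub>R g t))"
    unfolding tail_int_def mus_def set_lebesgue_integral_def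
    using Cs_pos by (subst integral_density) auto
  also have "\<dots> = (LINT t|lborel. Cs s * (indicator {\<delta><..} t *\<^sub>R (W t * g t)))"
    using \<delta> by (intro Bochner_Integration.integral_cong) (auto simp: W_def indicator_def)
  finally show ?thesis
    by (simp add: set_lebesgue_integral_def)
qed

lemma measure_mus_Ioi:
  assumes "0 < \<epsilon>"
  shows "measure (mus s) {\<epsilon><..} = Cs s * \<epsilon> powr (- 2 * s) / (2 * s)"
proof -
  have "tail_int s \<epsilon> (\<lambda>_. 1) = measure (mus s) {\<epsilon><..}"
    by (simp add: tail_int_def set_lebesgue_integral_def mus_def)
  then show ?thesis
    using tail_int_eq[of "\<lambda>_. 1" \<epsilon>] W_Ioi[OF assms] assms by simp
qed

lemma W_bounded_Ioi_integrable:
  assumes [measurable]: "g \<in> borel_measurable borel"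
    and "0 < a" and B: "\<And>t. a < t \<Longrightarrow> \<bar>g t\<bar> \<le> B"
  shows "set_integrable lborel {a<..} (\<lambda>t. W t * g t)"
proof (rule set_integrable_bound)
  show "set_integrable lborel {a<..} (\<lambda>t. B * W t)"
    using W_Ioi(1)[OF \<open>0 < a\<close>] by simp
  show "set_borel_measurable lborel {a<..} (\<lambda>t. W t * g t)"
    unfolding set_borel_measurable_def by measurable
  show "AE t in lborel. t \<in> {a<..} \<longrightarrow> norm (W t * g t) \<le> norm (B * W t)"
  proof (intro AE_I2 impI)
    fix t assume "t \<in> {a<..}"
    then have "\<bar>g t\<bar> \<le> \<bar>B\<bar>" using B[of t] by auto
    then show "norm (W t * g t) \<le> norm (B * W t)"
      using W_nonneg[of t] by (simp add: abs_mult mult.commute mult_right_mono)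
  qed
qed

end

subsection \<open>The modulus of continuity on spheres\<close>

text \<open>Concavity keeps the sine above its chord from 0 to pi/2, whose slope 2/pi exceeds 1/2.
  This serves to bound an arc of the sphere by its chord.\<close>

lemma half_le_sin:
  fixes x :: real
  assumes "0 \<le> x" "x \<le> pi / 2"
  shows "x / 2 \<le> sin x"
proof -
  have "concave_on {0..pi} sin"
    by (rule f''_le0_imp_concave[where f' = cos and f'' = "\<lambda>x. - sin x"])
      (auto intro!: derivative_eq_intros sin_ge_zero)
  from concave_onD[OF this, of "x / (pi / 2)" 0 "pi / 2"]
  have "x / (pi / 2) \<le> sin x"
    using assms by (simp add: field_simps)
  moreover have "x / 2 \<le> x / (pi / 2)"
    using assms pi_less_4 by (intro divide_left_mono) auto
  ultimately show ?thesis by linarith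
qed

text \<open>The angle is the arccosine of the component of \<open>y\<close> along \<open>e\<close>,
  and \<open>u\<close> is the normalized remainder. If \<open>y\<close> is \<open>e\<close> or
  \<open>-e\<close> the remainder vanishes, and any unit vector orthogonal to \<open>e\<close> will
  do; the dimension hypothesis supplies one.\<close>

lemma unit_vector_polar:
  fixes y e :: "'a::euclidean_space"
  assumes dim: "2 \<le> DIM('a)" and y: "norm y = 1" and e: "norm e = 1"
  obtains u \<theta> where "norm u = 1" "u \<bullet> e = 0" "0 \<le> \<theta>" "\<theta> \<le> pi"
    "y = cos \<theta> *\<^sub>R e + sin \<theta> *\<^sub>R u"
proof -
  define c where "c = y \<bullet> e"
  define r where "r = y - c *\<^sub>R e"
  have c: "\<bar>c\<bar> \<le> 1"
    using Cauchy_Schwarz_ineq2[of y e] y e by (simp add: c_def)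
  have ee: "e \<bullet> e = 1" "y \<bullet> y = 1"
    using y e by (simp_all add: dot_square_norm)
  have re: "r \<bullet> e = 0"
    by (simp add: r_def inner_diff_left ee c_def)
  have "r \<bullet> r = 1 - c\<^sup>2"
    by (simp add: r_def inner_diff_left inner_diff_right ee c_def inner_commute power2_eq_square)
  then have nr: "norm r = sin (arccos c)"
    using c by (simp add: norm_eq_sqrt_inner sin_arccos)
  obtain u where u: "norm u = 1" "u \<bullet> e = 0" "r = norm r *\<^sub>R u"
  proof (cases "r = 0")
    case True
    obtain v where "v \<noteq> 0" "orthogonal e v"
      using orthogonal_to_vector_exists[OF dim] by metis
    then show ?thesis
      using True by (intro that[of "v /\<^sub>R norm v"]) (auto simp: orthogonal_def inner_commute)
  next
    case False
    then show ?thesis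
      using re by (intro that[of "r /\<^sub>R norm r"]) auto
  qed
  show ?thesis
  proof (rule that[of u "arccos c"])
    show "0 \<le> arccos c" "arccos c \<le> pi"
      using c by (auto intro: arccos_lbound arccos_ubound)
    show "y = cos (arccos c) *\<^sub>R e + sin (arccos c) *\<^sub>R u"
      using c u(3)[unfolded nr] by (simp add: cos_arccos_abs r_def algebra_simps)
  qed (use u in auto)
qed

lemma norm_arc_diff:
  fixes e u :: "'a::real_inner"
  assumes e: "norm e = 1" and u: "norm u = 1" "u \<bullet> e = 0"
  shows "norm ((cos \<alpha> *\<^sub>R e + sin \<alpha> *\<^sub>R u) - (cos \<beta> *\<^sub>R e + sin \<beta> *\<^sub>R u)) = 2 * \<bar>sin ((\<alpha> - \<beta>) / 2)\<bar>"
proof -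
  have ee: "e \<bullet> e = 1" "u \<bullet> u = 1" "e \<bullet> u = 0"
    using u e by (simp_all add: dot_square_norm inner_commute)
  have "(norm ((cos \<alpha> *\<^sub>R e + sin \<alpha> *\<^sub>R u) - (cos \<beta> *\<^sub>R e + sin \<beta> *\<^sub>R u)))\<^sup>2
      = ((cos \<alpha>)\<^sup>2 + (sin \<alpha>)\<^sup>2) + ((cos \<beta>)\<^sup>2 + (sin \<beta>)\<^sup>2) - 2 * (cos \<alpha> * cos \<beta> + sin \<alpha> * sin \<beta>)"
    unfolding power2_norm_eq_inner
    by (simp add: inner_add_left inner_add_right inner_diff_left inner_diff_right ee u(2)
        power2_eq_square algebra_simps)
  also have "\<dots> = 2 - 2 * cos (2 * ((\<alpha> - \<beta>) / 2))"
    using cos_diff[of \<alpha> \<beta>] by (simp del: diff_divide_distrib right_diff_distrib_numeral)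
  also have "\<dots> = (2 * \<bar>sin ((\<alpha> - \<beta>) / 2)\<bar>)\<^sup>2"
    by (subst cos_double_sin) (simp add: power_mult_distrib)
  finally show ?thesis
    by (rule power2_eq_imp_eq) auto
qed

lemma INF_real_uminus: "(INF y\<in>S. f y) = - (SUP y\<in>S. - f y :: real)"
  by (simp add: Inf_real_def image_image)

lemma abs_telescope_le:
  fixes f :: "nat \<Rightarrow> real"
  assumes "\<And>j. j < n \<Longrightarrow> \<bar>f (Suc j) - f j\<bar> \<le> w"
  shows "\<bar>f n - f 0\<bar> \<le> real n * w"
proof -
  have "\<bar>\<Sum>j<n. f (Suc j) - f j\<bar> \<le> (\<Sum>j<n. w)"
    using assms by (intro order_trans[OF sum_abs] sum_mono) auto
  then show ?thesis by (simp add: sum_lessThan_telescope)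
qed

lemma omega_bdd:
  fixes \<phi> :: "'a::real_normed_vector \<Rightarrow> real"
  assumes "bounded (range \<phi>)"
  shows "bdd_above ((\<lambda>zw. \<bar>\<phi> (fst zw) - \<phi> (snd zw)\<bar>) ` S)"
proof -
  obtain B where "\<And>z. \<bar>\<phi> z\<bar> \<le> B"
    using assms by (auto simp: bounded_iff)
  then have "\<bar>\<phi> (fst zw) - \<phi> (snd zw)\<bar> \<le> 2 * B" for zw
    by (smt (verit) abs_triangle_ineq4)
  then show ?thesis by (intro bdd_aboveI2) auto
qed

lemma abs_diff_le_omega:
  assumes "bounded (range \<phi>)" "z \<notin> cball x \<eta>" "w \<notin> cball x \<eta>" "dist z w \<le> a"
  shows "\<bar>\<phi> z - \<phi> w\<bar> \<le> omega \<phi> x \<eta> a"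
  unfolding omega_def using assms
  by (intro cSUP_upper2[where x = "(z, w)"] omega_bdd) auto

text \<open>The supremum of an empty set of reals is unspecified, so sign and monotonicity of
  \<open>omega\<close> first require a point outside the ball.\<close>

lemma exists_not_in_cball:
  fixes x :: "'a::euclidean_space"
  shows "\<exists>z. z \<notin> cball x \<eta>"
  using not_bounded_UNIV[where 'a = 'a] bounded_subset[OF bounded_cball[of x \<eta>], of UNIV] by blast

lemma omega_nonneg:
  fixes \<phi> :: "'a::euclidean_space \<Rightarrow> real"
  assumes "bounded (range \<phi>)" "0 \<le> a"
  shows "0 \<le> omega \<phi> x \<eta> a"
proof -
  obtain z where "z \<notin> cball x \<eta>" using exists_not_in_cball by blast
  from abs_diff_le_omega[OF assms(1) this this] assms(2) show ?thesis by simp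
qed

lemma omega_mono:
  fixes \<phi> :: "'a::euclidean_space \<Rightarrow> real"
  assumes "bounded (range \<phi>)" "0 \<le> a" "a \<le> b"
  shows "omega \<phi> x \<eta> a \<le> omega \<phi> x \<eta> b"
proof -
  obtain z where "z \<notin> cball x \<eta>" using exists_not_in_cball by blast
  then have ne: "(z, z) \<in> {(z, w). z \<notin> cball x \<eta> \<and> w \<notin> cball x \<eta> \<and> dist z w \<le> a}"
    using assms by auto
  have "{(z, w). z \<notin> cball x \<eta> \<and> w \<notin> cball x \<eta> \<and> dist z w \<le> a} \<noteq> {}"
    using ne by blast
  then show ?thesis
    unfolding omega_def
    by (rule cSUP_subset_mono[OF _ omega_bdd[OF assms(1)]]) (use assms in auto)
qed

text \<open>The straight segment between the two points may cross the ball, so the chain of points at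
  mutual distance at most a is taken along the great arc of the sphere of radius t.\<close>

lemma sphere_diff_le_omega:
  fixes \<phi> :: "'a::euclidean_space \<Rightarrow> real"
  assumes bdd: "bounded (range \<phi>)" and dim: "2 \<le> DIM('a)"
    and y: "norm y = 1" and e: "norm e = 1" and \<eta>: "0 < \<eta>" and t: "\<eta> < t"
  shows "\<bar>\<phi> (x + t *\<^sub>R y) - \<phi> (x + t *\<^sub>R e)\<bar> \<le> 2 * (1 + t) * omega \<phi> x \<eta> (norm (y - e))"
proof -
  obtain u \<theta> where u: "norm u = 1" "u \<bullet> e = 0" and \<theta>: "0 \<le> \<theta>" "\<theta> \<le> pi"
    and y_eq: "y = cos \<theta> *\<^sub>R e + sin \<theta> *\<^sub>R u"
    using unit_vector_polar[OF dim y e] by blast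
  define c where "c \<alpha> = cos \<alpha> *\<^sub>R e + sin \<alpha> *\<^sub>R u" for \<alpha> :: real
  define w where "w = omega \<phi> x \<eta> (norm (y - e))"
  \<comment> \<open>With n at least 2 t, each of n equal pieces of the arc of radius t has length at
    most t \<theta> / n, hence at most \<theta> / 2, which \<open>half_le_sin\<close> bounds by the
    chord |y - e|. Rounding up adds at most one piece, so n is at most 2 (1 + t).\<close>
  define n where "n = nat \<lceil>2 * t\<rceil>"
  have "0 < t" using \<eta> t by simp
  then have n: "2 * t \<le> real n" "real n \<le> 2 * t + 1"
    unfolding n_def by linarith+
  then have n0: "0 < real n" using \<open>0 < t\<close> by linarith
  have c_diff: "norm (c \<alpha> - c \<beta>) = 2 * \<bar>sin ((\<alpha> - \<beta>) / 2)\<bar>" for \<alpha> \<beta>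
    unfolding c_def by (rule norm_arc_diff[OF e u])
  have c_norm: "norm (c \<alpha>) = 1" for \<alpha>
  proof -
    have "(norm (c \<alpha>))\<^sup>2 = (cos \<alpha>)\<^sup>2 * (norm e)\<^sup>2 + (sin \<alpha>)\<^sup>2 * (norm u)\<^sup>2"
      unfolding power2_norm_eq_inner c_def using u(2)
      by (simp add: inner_add_left inner_add_right inner_commute power2_eq_square algebra_simps)
    then have "(norm (c \<alpha>))\<^sup>2 = 1\<^sup>2" using e u by simp
    then show ?thesis by (rule power2_eq_imp_eq) auto
  qed
  have c0: "c 0 = e" and c\<theta>: "c \<theta> = y" by (simp_all add: c_def y_eq)
  have ye: "norm (y - e) = 2 * sin (\<theta> / 2)"
    using c_diff[of \<theta> 0] \<theta> by (simp add: c0 c\<theta> sin_ge_zero)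
  define f where "f j = \<phi> (x + t *\<^sub>R c (real j * \<theta> / real n))" for j
  have "\<bar>f n - f 0\<bar> \<le> real n * w"
  proof (rule abs_telescope_le)
    fix j
    have "norm (c (real (Suc j) * \<theta> / real n) - c (real j * \<theta> / real n))
        = 2 * \<bar>sin (\<theta> / real n / 2)\<bar>"
      unfolding c_diff by (simp add: add_divide_distrib diff_divide_distrib algebra_simps)
    also have "\<dots> \<le> \<theta> / real n"
      using abs_sin_x_le_abs_x[of "\<theta> / real n / 2"] \<theta> n0 by simp
    finally have "t * norm (c (real (Suc j) * \<theta> / real n) - c (real j * \<theta> / real n)) \<le> t * (\<theta> / real n)"
      using \<open>0 < t\<close> by (intro mult_left_mono) auto
    also have "\<dots> \<le> \<theta> / 2"
    proof -
      have "(2 * t) * \<theta> \<le> real n * \<theta>" using n \<theta> by (intro mult_right_mono) auto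
      then show ?thesis using n0 by (simp add: field_simps)
    qed
    also have "\<dots> \<le> norm (y - e)"
      using half_le_sin[of "\<theta> / 2"] \<theta> ye by simp
    finally have "dist (x + t *\<^sub>R c (real (Suc j) * \<theta> / real n)) (x + t *\<^sub>R c (real j * \<theta> / real n)) \<le> norm (y - e)"
      using \<open>0 < t\<close> by (simp add: dist_norm scaleR_diff_right[symmetric])
    then show "\<bar>f (Suc j) - f j\<bar> \<le> w"
      unfolding f_def w_def using t \<open>0 < t\<close>
      by (intro abs_diff_le_omega[OF bdd]) (auto simp: dist_norm c_norm)
  qed
  also have "\<dots> \<le> 2 * (1 + t) * w"
    using n omega_nonneg[OF bdd, of "norm (y - e)" x \<eta>] unfolding w_def
    by (intro mult_right_mono) auto
  finally show ?thesis
    using n0 by (simp add: f_def w_def c0 c\<theta>)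
qed

subsection \<open>First and second order expansions\<close>

locale nonlocal_data = fractional_order s for s +
  fixes \<phi> :: "'a::euclidean_space \<Rightarrow> real" and x :: 'a and \<eta> :: real
    and G :: "'a \<Rightarrow> 'a" and H :: "'a \<Rightarrow> 'a \<Rightarrow>\<^sub>L 'a"
  assumes eta_pos: "0 < \<eta>"
    and phi_bdd: "bounded (range \<phi>)"
    and phi_borel [measurable]: "\<phi> \<in> borel_measurable borel"
    and grad: "\<And>z. z \<in> cball x \<eta> \<Longrightarrow> (\<phi> has_derivative (\<lambda>h. G z \<bullet> h)) (at z within cball x \<eta>)"
    and hess: "\<And>z. z \<in> cball x \<eta> \<Longrightarrow> (G has_derivative blinfun_apply (H z)) (at z within cball x \<eta>)"
    and hess_cont: "continuous_on (cball x \<eta>) H"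
    and px_ne: "G x \<noteq> 0"
begin

definition e :: 'a where "e = G x /\<^sub>R norm (G x)"

text \<open>Twice the C_x of the theorem. Without the factor 1/2 it bounds the variation of the
  gradient about x.\<close>

definition K :: real where "K = (SUP y\<in>ball x \<eta>. norm (H y))"

definition D :: "real \<Rightarrow> real" where "D \<epsilon> = (SUP y\<in>ball x \<epsilon>. norm (H y - H x))"

text \<open>Lets upper estimates be reused for -\<phi>, where suprema become infima. The unit
  gradient changes sign, while \<open>K\<close>, \<open>D\<close> and the modulus are even in
  \<phi>.\<close>

lemma nonlocal_data_uminus: "nonlocal_data s (\<lambda>z. - \<phi> z) x \<eta> (\<lambda>z. - G z) (\<lambda>z. - H z)"
proof unfold_locales
  show "bounded (range (\<lambda>z. - \<phi> z))"
    using phi_bdd by (simp add: bounded_iff)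
  show "((\<lambda>z. - \<phi> z) has_derivative (\<lambda>h. - G z \<bullet> h)) (at z within cball x \<eta>)" if "z \<in> cball x \<eta>" for z
    using has_derivative_minus[OF grad[OF that]] by simp
  show "((\<lambda>z. - G z) has_derivative blinfun_apply (- H z)) (at z within cball x \<eta>)" if "z \<in> cball x \<eta>" for z
    using has_derivative_minus[OF hess[OF that]] by (simp add: uminus_blinfun.rep_eq fun_Compl_def)
  show "continuous_on (cball x \<eta>) (\<lambda>z. - H z)"
    using hess_cont by (intro continuous_intros)
qed (use eta_pos px_ne in auto)

lemma norm_e [simp]: "norm e = 1"
  using px_ne by (simp add: e_def)

lemma G_inner_e: "G x \<bullet> e = norm (G x)"
  using px_ne by (simp add: e_def dot_square_norm power2_eq_square)

lemma G_eq: "G x = norm (G x) *\<^sub>R e"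
  using px_ne by (simp add: e_def)

text \<open>For unit vectors |y - e|^2 = 2 - 2 (e . y), so the linear form is largest exactly at e
  and falls off quadratically. This is the source of the square in \<open>kappa\<close>.\<close>

lemma G_inner_diff:
  assumes "norm y = 1"
  shows "G x \<bullet> (y - e) = - norm (G x) * (norm (y - e))\<^sup>2 / 2"
proof -
  have "y \<bullet> y = 1" "e \<bullet> e = 1"
    using assms by (simp_all add: dot_square_norm)
  then have "(norm (y - e))\<^sup>2 = 2 - 2 * (e \<bullet> y)"
    unfolding power2_norm_eq_inner by (simp add: inner_diff_left inner_diff_right inner_commute)
  moreover have "G x \<bullet> (y - e) = norm (G x) * (e \<bullet> y - 1)"
    by (subst G_eq) (simp add: inner_diff_right dot_square_norm algebra_simps)
  moreover from calculation(1) have "e \<bullet> y - 1 = - (norm (y - e))\<^sup>2 / 2"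
    by simp
  ultimately show ?thesis by simp
qed

lemma phi_bound: obtains B where "0 \<le> B" "\<And>z. \<bar>\<phi> z\<bar> \<le> B"
proof -
  obtain B where "\<And>z. \<bar>\<phi> z\<bar> \<le> B"
    using phi_bdd by (auto simp: bounded_iff)
  then show ?thesis using that[of B] abs_ge_zero order_trans by blast
qed

lemma H_bdd:
  assumes "0 \<le> r" "r \<le> \<eta>"
  shows "bdd_above ((\<lambda>y. norm (H y)) ` ball x r)" "bdd_above ((\<lambda>y. norm (H y - H x)) ` ball x r)"
proof -
  have "compact (H ` cball x \<eta>)"
    using hess_cont by (intro compact_continuous_image) auto
  then have "\<exists>M. \<forall>y\<in>cball x \<eta>. norm (H y) \<le> M"
    using compact_imp_bounded[of "H ` cball x \<eta>"] by (simp add: bounded_iff)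
  then obtain M where M: "\<And>y. y \<in> cball x \<eta> \<Longrightarrow> norm (H y) \<le> M"
    by blast
  then have M': "norm (H y) \<le> M" if "y \<in> ball x r" for y
    using that assms by auto
  then show "bdd_above ((\<lambda>y. norm (H y)) ` ball x r)"
    by (intro bdd_aboveI2)
  have "norm (H y - H x) \<le> 2 * M" if "y \<in> ball x r" for y
    using M'[OF that] M[of x] norm_triangle_ineq4[of "H y" "H x"] eta_pos by simp
  then show "bdd_above ((\<lambda>y. norm (H y - H x)) ` ball x r)"
    by (intro bdd_aboveI2)
qed

text \<open>\<open>K\<close> is a supremum over the open ball, while the mean value estimates live
  on the closed one; continuity of \<open>H\<close> carries the bound to the boundary. The same
  holds for \<open>D\<close> below.\<close>

lemma norm_H_le_K:
  assumes "z \<in> cball x \<eta>"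
  shows "norm (H z) \<le> K"
proof (rule continuous_on_closure_norm_le[where s = "ball x \<eta>"])
  show "\<forall>y\<in>ball x \<eta>. norm (H y) \<le> K"
    unfolding K_def using H_bdd(1)[of \<eta>] eta_pos by (auto intro: cSUP_upper)
qed (use assms eta_pos hess_cont in auto)

lemma K_nonneg: "0 \<le> K"
  using norm_H_le_K[of x] norm_ge_zero[of "H x"] eta_pos by (smt (verit) centre_in_cball)

lemma norm_H_diff_le_D:
  assumes "0 < \<epsilon>" "\<epsilon> \<le> \<eta>" "z \<in> cball x \<epsilon>"
  shows "norm (H z - H x) \<le> D \<epsilon>"
proof (rule continuous_on_closure_norm_le[where s = "ball x \<epsilon>" and f = "\<lambda>z. H z - H x"])
  show "\<forall>y\<in>ball x \<epsilon>. norm (H y - H x) \<le> D \<epsilon>"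
    unfolding D_def using H_bdd(2)[of \<epsilon>] assms by (auto intro: cSUP_upper)
  have "continuous_on (cball x \<epsilon>) H"
    using hess_cont by (rule continuous_on_subset) (use assms in auto)
  then show "continuous_on (closure (ball x \<epsilon>)) (\<lambda>z. H z - H x)"
    using assms by (auto intro!: continuous_intros)
qed (use assms in auto)

lemma D_nonneg:
  assumes "0 < \<epsilon>" "\<epsilon> \<le> \<eta>"
  shows "0 \<le> D \<epsilon>"
  using norm_H_diff_le_D[OF assms, of x] assms by simp

lemma G_lipschitz:
  assumes "z \<in> cball x \<eta>"
  shows "norm (G z - G x) \<le> K * norm (z - x)"
proof (rule differentiable_bound[where S = "cball x \<eta>" and f' = "\<lambda>z. blinfun_apply (H z)"])
  show "onorm (blinfun_apply (H z)) \<le> K" if "z \<in> cball x \<eta>" for z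
    using norm_H_le_K[OF that] by (simp add: norm_blinfun.rep_eq)
qed (use assms hess eta_pos in auto)

text \<open>Mean value inequality for \<phi> minus its linear part at x, on the ball of radius t,
  where the gradient deviates by at most K t. The factor \<open>norm (y - y')\<close> in the error
  is what makes the Hessian loss proportional to the distance of the directions. Admitting norms
  below 1 allows y' = 0, the comparison with \<phi> x.\<close>

lemma phi_linearization:
  assumes t: "0 \<le> t" "t \<le> \<eta>" and y: "norm y \<le> 1" "norm y' \<le> 1"
  shows "\<bar>\<phi> (x + t *\<^sub>R y) - \<phi> (x + t *\<^sub>R y') - t * (G x \<bullet> (y - y'))\<bar> \<le> K * norm (y - y') * t\<^sup>2"
proof -
  have sub: "cball x t \<subseteq> cball x \<eta>" using t by auto
  have in_ball: "x + t *\<^sub>R v \<in> cball x t" if "norm v \<le> 1" for v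
    using that t by (simp add: dist_norm mult_left_le)
  have "norm (\<phi> (x + t *\<^sub>R y) - \<phi> (x + t *\<^sub>R y') - G x \<bullet> ((x + t *\<^sub>R y) - (x + t *\<^sub>R y')))
      \<le> norm ((x + t *\<^sub>R y) - (x + t *\<^sub>R y')) * (K * t)"
  proof (rule differentiable_bound_linearization[where f' = "\<lambda>z h. G z \<bullet> h" and S = "cball x t"])
    fix \<tau> :: real assume \<tau>: "\<tau> \<in> {0..1}"
    have "(1 - \<tau>) *\<^sub>R (x + t *\<^sub>R y') + \<tau> *\<^sub>R (x + t *\<^sub>R y) \<in> cball x t"
      using in_ball y \<tau> by (intro convexD[OF convex_cball]) auto
    then show "(x + t *\<^sub>R y') + \<tau> *\<^sub>R ((x + t *\<^sub>R y) - (x + t *\<^sub>R y')) \<in> cball x t"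
      by (simp add: algebra_simps)
  next
    fix z assume z: "z \<in> cball x t"
    then show "(\<phi> has_derivative (\<bullet>) (G z)) (at z within cball x t)"
      using has_derivative_subset[OF grad sub] sub by blast
    have "norm (G z - G x) \<le> K * t"
    proof -
      have "norm (G z - G x) \<le> K * norm (z - x)"
        using G_lipschitz z sub by blast
      also have "\<dots> \<le> K * t"
        using z K_nonneg by (intro mult_left_mono) (auto simp: dist_norm norm_minus_commute)
      finally show ?thesis .
    qed
    then have "norm ((\<bullet>) (G z) h - (\<bullet>) (G x) h) \<le> K * t * norm h" for h
      using Cauchy_Schwarz_ineq2[of "G z - G x" h] mult_right_mono[OF _ norm_ge_zero[of h]]
      by (fastforce simp: inner_diff_left intro: order_trans)
    then show "onorm ((\<bullet>) (G z) - (\<bullet>) (G x)) \<le> K * t"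
      using K_nonneg t by (intro onorm_bound) auto
  qed (use t in auto)
  moreover have "(x + t *\<^sub>R y) - (x + t *\<^sub>R y') = t *\<^sub>R (y - y')"
    by (simp add: algebra_simps)
  ultimately show ?thesis
    using t by (simp add: power2_eq_square mult_ac)
qed

lemma G_linearization:
  assumes "0 < \<epsilon>" "\<epsilon> \<le> \<eta>" "z \<in> cball x \<epsilon>"
  shows "norm (G z - G x - H x (z - x)) \<le> norm (z - x) * D \<epsilon>"
proof (rule differentiable_bound_linearization[where f' = "\<lambda>z. blinfun_apply (H z)" and S = "cball x \<epsilon>"])
  fix \<tau> :: real assume \<tau>: "\<tau> \<in> {0..1}"
  have "(1 - \<tau>) *\<^sub>R x + \<tau> *\<^sub>R z \<in> cball x \<epsilon>"
    using assms \<tau> by (intro convexD[OF convex_cball]) auto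
  then show "x + \<tau> *\<^sub>R (z - x) \<in> cball x \<epsilon>"
    by (simp add: algebra_simps)
next
  fix z assume z: "z \<in> cball x \<epsilon>"
  then show "(G has_derivative blinfun_apply (H z)) (at z within cball x \<epsilon>)"
    using assms by (intro has_derivative_subset[OF hess]) auto
  have "blinfun_apply (H z) - blinfun_apply (H x) = blinfun_apply (H z - H x)"
    by (auto simp: minus_blinfun.rep_eq)
  then show "onorm (blinfun_apply (H z) - blinfun_apply (H x)) \<le> D \<epsilon>"
    using norm_H_diff_le_D[OF assms(1,2) z] by (simp add: norm_blinfun.rep_eq)
qed (use assms in auto)

text \<open>The remainder f along the segment satisfies f 0 = 0 and |f' \<tau>| <= q \<tau>, by
  \<open>G_linearization\<close>. Monotonicity of f - q \<tau>^2 / 2 and of f + q \<tau>^2 / 2 then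
  gives |f 1| <= q / 2; a plain mean value bound would lose the factor 1/2.\<close>

lemma phi_taylor:
  assumes \<epsilon>: "0 < \<epsilon>" "\<epsilon> < \<eta>" and v: "norm v \<le> \<epsilon>"
  shows "\<bar>\<phi> (x + v) - \<phi> x - G x \<bullet> v - (H x v \<bullet> v) / 2\<bar> \<le> D \<epsilon> / 2 * (norm v)\<^sup>2"
proof -
  define f where "f \<tau> = \<phi> (x + \<tau> *\<^sub>R v) - \<phi> x - \<tau> * (G x \<bullet> v) - \<tau>\<^sup>2 * (H x v \<bullet> v) / 2" for \<tau> :: real
  define f' where "f' \<tau> = (G (x + \<tau> *\<^sub>R v) - G x - H x ((x + \<tau> *\<^sub>R v) - x)) \<bullet> v" for \<tau> :: real
  define q where "q = D \<epsilon> * (norm v)\<^sup>2"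
  have seg: "x + \<tau> *\<^sub>R v \<in> cball x \<epsilon>" if "0 \<le> \<tau>" "\<tau> \<le> 1" for \<tau>
    using that v by (simp add: dist_norm) (smt (verit) mult_left_le_one_le norm_ge_zero)
  have deriv: "(f has_real_derivative f' \<tau>) (at \<tau>)" if "0 \<le> \<tau>" "\<tau> \<le> 1" for \<tau>
  proof -
    have "x + \<tau> *\<^sub>R v \<in> ball x \<eta>" using seg[OF that] \<epsilon> by auto
    \<comment> \<open>Strictness of \<epsilon> < \<eta> keeps the segment in the open ball, where
      the derivative within the closed ball is a full derivative.\<close>
    then have "at (x + \<tau> *\<^sub>R v) within cball x \<eta> = at (x + \<tau> *\<^sub>R v)"
      by (intro at_within_interior) (simp add: interior_cball)
    then have *: "(\<phi> has_derivative (\<lambda>h. G (x + \<tau> *\<^sub>R v) \<bullet> h)) (at (x + \<tau> *\<^sub>R v))"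
      using grad[of "x + \<tau> *\<^sub>R v"] \<open>x + \<tau> *\<^sub>R v \<in> ball x \<eta>\<close> by auto
    have "((\<lambda>\<tau>. \<phi> (x + \<tau> *\<^sub>R v)) has_derivative (\<lambda>h. G (x + \<tau> *\<^sub>R v) \<bullet> (h *\<^sub>R v))) (at \<tau>)"
      by (rule has_derivative_compose[where f = "\<lambda>\<tau>. x + \<tau> *\<^sub>R v", OF _ *])
        (auto intro!: derivative_eq_intros)
    then have **: "((\<lambda>\<tau>. \<phi> (x + \<tau> *\<^sub>R v)) has_real_derivative (G (x + \<tau> *\<^sub>R v) \<bullet> v)) (at \<tau>)"
      by (simp add: has_field_derivative_def mult_commute_abs)
    show ?thesis
      unfolding f_def[abs_def] f'_def
      by (rule derivative_eq_intros ** refl | simp)+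
        (simp add: inner_diff_left blinfun.scaleR_right)
  qed
  have bound: "\<bar>f' \<tau>\<bar> \<le> q * \<tau>" if "0 \<le> \<tau>" "\<tau> \<le> 1" for \<tau>
  proof -
    have "\<bar>f' \<tau>\<bar> \<le> norm (G (x + \<tau> *\<^sub>R v) - G x - H x ((x + \<tau> *\<^sub>R v) - x)) * norm v"
      unfolding f'_def by (rule Cauchy_Schwarz_ineq2)
    also have "\<dots> \<le> norm ((x + \<tau> *\<^sub>R v) - x) * D \<epsilon> * norm v"
      using G_linearization[OF _ _ seg[OF that]] \<epsilon> by (intro mult_right_mono) auto
    also have "\<dots> = q * \<tau>"
      using that by (simp add: q_def power2_eq_square)
    finally show ?thesis .
  qed
  have "f 1 - q * 1\<^sup>2 / 2 \<le> f 0 - q * 0\<^sup>2 / 2"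
  proof (rule DERIV_nonpos_imp_nonincreasing[where f = "\<lambda>\<tau>. f \<tau> - q * \<tau>\<^sup>2 / 2"])
    fix \<tau> :: real assume \<tau>: "0 \<le> \<tau>" "\<tau> \<le> 1"
    have "((\<lambda>\<tau>. f \<tau> - q * \<tau>\<^sup>2 / 2) has_real_derivative (f' \<tau> - q * \<tau>)) (at \<tau>)"
      by (rule derivative_eq_intros deriv[OF \<tau>] refl | simp)+
    moreover have "f' \<tau> - q * \<tau> \<le> 0" using bound[OF \<tau>] by linarith
    ultimately show "\<exists>y. ((\<lambda>\<tau>. f \<tau> - q * \<tau>\<^sup>2 / 2) has_real_derivative y) (at \<tau>) \<and> y \<le> 0" by blast
  qed simp
  moreover have "f 0 + q * 0\<^sup>2 / 2 \<le> f 1 + q * 1\<^sup>2 / 2"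
  proof (rule DERIV_nonneg_imp_nondecreasing[where f = "\<lambda>\<tau>. f \<tau> + q * \<tau>\<^sup>2 / 2"])
    fix \<tau> :: real assume \<tau>: "0 \<le> \<tau>" "\<tau> \<le> 1"
    have "((\<lambda>\<tau>. f \<tau> + q * \<tau>\<^sup>2 / 2) has_real_derivative (f' \<tau> + q * \<tau>)) (at \<tau>)"
      by (rule derivative_eq_intros deriv[OF \<tau>] refl | simp)+
    moreover have "0 \<le> f' \<tau> + q * \<tau>" using bound[OF \<tau>] by linarith
    ultimately show "\<exists>y. ((\<lambda>\<tau>. f \<tau> + q * \<tau>\<^sup>2 / 2) has_real_derivative y) (at \<tau>) \<and> 0 \<le> y" by blast
  qed simp
  moreover have "f 0 = 0" by (simp add: f_def)
  ultimately have "\<bar>f 1\<bar> \<le> q / 2" by simp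
  then show ?thesis by (simp add: f_def q_def)
qed

end

subsection \<open>Tail integrals near 0\<close>

lemma set_integral_Ioi_split:
  fixes f :: "real \<Rightarrow> real"
  assumes "a \<le> r" "set_integrable lborel {a<..r} f" "set_integrable lborel {r<..} f"
  shows "(LINT t:{a<..}|lborel. f t) = (LINT t:{a<..r}|lborel. f t) + (LINT t:{r<..}|lborel. f t)"
proof -
  have "{a<..} = {a<..r} \<union> {r<..}" using assms by auto
  moreover have "{a<..r} \<inter> {r<..} = {}" by auto
  ultimately show ?thesis using set_integral_Un[OF _ assms(2,3)] by simp
qed

context fractional_order
begin

lemma powr_at_right_0_at_top: "filterlim (\<lambda>\<delta>. \<delta> powr (1 - 2 * s)) at_top (at_right 0)"
proof -
  have "filterlim (\<lambda>\<delta>. inverse (\<delta> powr (2 * s - 1))) at_top (at_right 0)"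
  proof (rule filterlim_compose[OF filterlim_inverse_at_top_right])
    have "((\<lambda>\<delta>. \<delta> powr (2 * s - 1)) \<longlongrightarrow> 0 powr (2 * s - 1)) (at_right 0)"
      using s_gt by (intro tendsto_powr' tendsto_ident_at tendsto_const)
        (auto simp: eventually_at_right_less eventually_at_filter)
    moreover have "\<forall>\<^sub>F \<delta> in at_right (0::real). \<delta> powr (2 * s - 1) > 0"
      by (auto simp: eventually_at_filter)
    ultimately show "filterlim (\<lambda>\<delta>. \<delta> powr (2 * s - 1)) (at_right 0) (at_right 0)"
      by (simp add: filterlim_at)
  qed
  then show ?thesis by (simp add: powr_minus[symmetric])
qed

text \<open>W t times t^2 is integrable at 0 because 2 - 2 s > 0. The tail from \<delta> misses only
  the integral over (0, \<delta>], of size at most M \<delta>^(2-2s) / (2-2s).\<close>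

lemma W_tail_tendsto:
  assumes [measurable]: "g \<in> borel_measurable borel" and "0 < r"
    and near: "\<And>t. 0 < t \<Longrightarrow> t \<le> r \<Longrightarrow> \<bar>g t\<bar> \<le> M * t\<^sup>2" and far: "\<And>t. \<bar>g t\<bar> \<le> B"
  shows "set_integrable lborel {0<..r} (\<lambda>t. W t * g t)"
    and "((\<lambda>\<delta>. LINT t:{\<delta><..}|lborel. W t * g t) \<longlongrightarrow>
      (LINT t:{0<..r}|lborel. W t * g t) + (LINT t:{r<..}|lborel. W t * g t)) (at_right 0)"
proof -
  have ae: "\<bar>W t * g t\<bar> \<le> M * (W t * t\<^sup>2)" if "0 < t" "t \<le> r" for t
    using mult_left_mono[OF near[OF that] W_nonneg[of t]] W_nonneg[of t]
    by (simp add: abs_mult mult_ac)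
  show int: "set_integrable lborel {0<..r} (\<lambda>t. W t * g t)"
  proof (rule set_integrable_bound)
    show "set_integrable lborel {0<..r} (\<lambda>t. M * (W t * t\<^sup>2))"
      using W_t2_Ioc_0(1)[OF \<open>0 < r\<close>] by (rule set_integrable_mult_right)
    show "set_borel_measurable lborel {0<..r} (\<lambda>t. W t * g t)"
      unfolding set_borel_measurable_def by measurable
    show "AE t in lborel. t \<in> {0<..r} \<longrightarrow> norm (W t * g t) \<le> norm (M * (W t * t\<^sup>2))"
      using ae by (intro AE_I2) force
  qed
  have far_int: "set_integrable lborel {r<..} (\<lambda>t. W t * g t)"
    using W_bounded_Ioi_integrable[of g r B] far \<open>0 < r\<close> by simp
  define I where "I = (LINT t:{0<..r}|lborel. W t * g t) + (LINT t:{r<..}|lborel. W t * g t)"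
  have "\<bar>(LINT t:{\<delta><..}|lborel. W t * g t) - I\<bar> \<le> M * (\<delta> powr (2 - 2 * s) / (2 - 2 * s))"
    if \<delta>: "0 < \<delta>" "\<delta> < r" for \<delta>
  proof -
    have i1: "set_integrable lborel {0<..\<delta>} (\<lambda>t. W t * g t)"
      and i2: "set_integrable lborel {\<delta><..r} (\<lambda>t. W t * g t)"
      using \<delta> by (auto intro: set_integrable_subset[OF int])
    have "{0<..r} = {0<..\<delta>} \<union> {\<delta><..r}" "{0<..\<delta>} \<inter> {\<delta><..r} = {}" using \<delta> by auto
    then have "(LINT t:{0<..r}|lborel. W t * g t)
        = (LINT t:{0<..\<delta>}|lborel. W t * g t) + (LINT t:{\<delta><..r}|lborel. W t * g t)"
      using set_integral_Un[OF _ i1 i2] by simp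
    then have "(LINT t:{\<delta><..}|lborel. W t * g t) - I = - (LINT t:{0<..\<delta>}|lborel. W t * g t)"
      unfolding I_def using set_integral_Ioi_split[OF _ i2 far_int] \<delta> by simp
    moreover have "(LINT t:{0<..\<delta>}|lborel. W t * g t) \<le> (LINT t:{0<..\<delta>}|lborel. M * (W t * t\<^sup>2))"
      using \<delta> W_t2_Ioc_0(1)[of \<delta>] ae
      by (intro set_integral_mono i1 set_integrable_mult_right) (auto simp: abs_le_iff)
    moreover have "(LINT t:{0<..\<delta>}|lborel. (- M) * (W t * t\<^sup>2)) \<le> (LINT t:{0<..\<delta>}|lborel. W t * g t)"
    proof (intro set_integral_mono i1)
      show "set_integrable lborel {0<..\<delta>} (\<lambda>t. (- M) * (W t * t\<^sup>2))"
        using W_t2_Ioc_0(1)[of \<delta>] \<delta> by (intro set_integrable_mult_right) auto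
      show "(- M) * (W t * t\<^sup>2) \<le> W t * g t" if "t \<in> {0<..\<delta>}" for t
        using ae[of t] that \<delta> by (auto simp: abs_le_iff)
    qed
    ultimately show ?thesis
      using W_t2_Ioc_0(2)[of \<delta>] \<delta> unfolding set_integral_mult_right by (auto simp: abs_le_iff)
  qed
  then have ev: "\<forall>\<^sub>F \<delta> in at_right 0. norm ((LINT t:{\<delta><..}|lborel. W t * g t) - I)
      \<le> M * (\<delta> powr (2 - 2 * s) / (2 - 2 * s))"
    using \<open>0 < r\<close> by (auto intro!: eventually_at_rightI[of 0 r])
  have "((\<lambda>\<delta>. M * (\<delta> powr (2 - 2 * s) / (2 - 2 * s))) \<longlongrightarrow> M * (0 powr (2 - 2 * s) / (2 - 2 * s))) (at_right 0)"
    using s_lt by (intro tendsto_intros tendsto_powr') (auto simp: eventually_at_filter)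
  then have "((\<lambda>\<delta>. M * (\<delta> powr (2 - 2 * s) / (2 - 2 * s))) \<longlongrightarrow> 0) (at_right 0)"
    by simp
  from Lim_null_comparison[OF ev this]
  show "((\<lambda>\<delta>. LINT t:{\<delta><..}|lborel. W t * g t) \<longlongrightarrow>
      (LINT t:{0<..r}|lborel. W t * g t) + (LINT t:{r<..}|lborel. W t * g t)) (at_right 0)"
    unfolding I_def[symmetric] by (rule LIM_zero_cancel)
qed

lemma W_tail_at_top:
  assumes [measurable]: "g \<in> borel_measurable borel" and "0 < r" "0 < c"
    and near: "\<And>t. 0 < t \<Longrightarrow> t \<le> r \<Longrightarrow> c * t - M * t\<^sup>2 \<le> g t" and far: "\<And>t. \<bar>g t\<bar> \<le> B"
    and "0 \<le> M"
  shows "filterlim (\<lambda>\<delta>. LINT t:{\<delta><..}|lborel. W t * g t) at_top (at_right 0)"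
proof -
  \<comment> \<open>Collects what stays bounded as \<delta> tends to 0: the value at r of the linear
    term, the full quadratic term and the integral beyond r. What remains is the multiple c / (2s-1)
    of \<delta>^(1-2s), which blows up because s > 1/2.\<close>
  define k where "k = - (c * r powr (1 - 2 * s) / (2 * s - 1)) - M * (r powr (2 - 2 * s) / (2 - 2 * s))
    + (LINT t:{r<..}|lborel. W t * g t)"
  have "k + c / (2 * s - 1) * \<delta> powr (1 - 2 * s) \<le> (LINT t:{\<delta><..}|lborel. W t * g t)"
    if \<delta>: "0 < \<delta>" "\<delta> < r" for \<delta>
  proof -
    have "set_integrable lborel {\<delta><..} (\<lambda>t. W t * g t)"
      using W_bounded_Ioi_integrable[of g \<delta> B] far \<delta> by simp
    then have i1: "set_integrable lborel {r<..} (\<lambda>t. W t * g t)"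
      and i2: "set_integrable lborel {\<delta><..r} (\<lambda>t. W t * g t)"
      using \<delta> by (auto intro: set_integrable_subset)
    have eq: "(LINT t:{\<delta><..}|lborel. W t * g t)
        = (LINT t:{\<delta><..r}|lborel. W t * g t) + (LINT t:{r<..}|lborel. W t * g t)"
      using set_integral_Ioi_split[OF _ i2 i1] \<delta> by simp
    have j1: "set_integrable lborel {\<delta><..r} (\<lambda>t. c * (W t * t))"
      and j2: "set_integrable lborel {\<delta><..r} (\<lambda>t. M * (W t * t\<^sup>2))"
      using W_t_Ioc(1)[of \<delta> r] W_t2_Ioc(1)[of \<delta> r] \<delta> by auto
    have "(LINT t:{\<delta><..r}|lborel. c * (W t * t) - M * (W t * t\<^sup>2)) \<le> (LINT t:{\<delta><..r}|lborel. W t * g t)"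
    proof (intro set_integral_mono i2 set_integral_diff(1) j1 j2)
      fix t assume "t \<in> {\<delta><..r}"
      then have "W t * (c * t - M * t\<^sup>2) \<le> W t * g t"
        using \<delta> by (intro mult_left_mono near W_nonneg) auto
      then show "c * (W t * t) - M * (W t * t\<^sup>2) \<le> W t * g t" by (simp add: algebra_simps)
    qed
    moreover have "(LINT t:{\<delta><..r}|lborel. c * (W t * t) - M * (W t * t\<^sup>2))
        = c * ((\<delta> powr (1 - 2 * s) - r powr (1 - 2 * s)) / (2 * s - 1))
          - M * ((r powr (2 - 2 * s) - \<delta> powr (2 - 2 * s)) / (2 - 2 * s))"
      using set_integral_diff(2)[OF j1 j2] W_t_Ioc(2)[of \<delta> r] W_t2_Ioc(2)[of \<delta> r] \<delta> by simp
    moreover have "M * ((r powr (2 - 2 * s) - \<delta> powr (2 - 2 * s)) / (2 - 2 * s))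
        \<le> M * (r powr (2 - 2 * s) / (2 - 2 * s))"
      using \<open>0 \<le> M\<close> s_lt by (intro mult_left_mono divide_right_mono) auto
    ultimately show ?thesis
      unfolding k_def eq by (simp add: diff_divide_distrib right_diff_distrib)
  qed
  then have "\<forall>\<^sub>F \<delta> in at_right 0. k + c / (2 * s - 1) * \<delta> powr (1 - 2 * s) \<le> (LINT t:{\<delta><..}|lborel. W t * g t)"
    using \<open>0 < r\<close> by (auto intro!: eventually_at_rightI[of 0 r])
  moreover have "filterlim (\<lambda>\<delta>. k + c / (2 * s - 1) * \<delta> powr (1 - 2 * s)) at_top (at_right 0)"
    using \<open>0 < c\<close> s_gt
    by (intro filterlim_tendsto_add_at_top[OF tendsto_const]
        filterlim_tendsto_pos_mult_at_top[OF tendsto_const _ powr_at_right_0_at_top]) auto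
  ultimately show ?thesis by (rule filterlim_at_top_mono[rotated])
qed

end

section \<open>Evaluation of the operator L_s\<close>

context nonlocal_data
begin

lemma phi_ray_measurable [measurable]: "(\<lambda>t. \<phi> (x + t *\<^sub>R y)) \<in> borel_measurable borel"
  by (rule measurable_compose[OF _ phi_borel])
    (intro borel_measurable_continuous_onI continuous_intros)

lemma Lphi_ray_measurable [measurable]:
  "(\<lambda>t. Lphi \<phi> x (t *\<^sub>R y) (t *\<^sub>R y')) \<in> borel_measurable borel"
  using phi_ray_measurable[of y] phi_ray_measurable[of "- y'"] unfolding Lphi_def by simp

lemma Lphi_bound: obtains B where "\<And>y y'. \<bar>Lphi \<phi> x y y'\<bar> \<le> B"
proof -
  obtain B where B: "\<And>z. \<bar>\<phi> z\<bar> \<le> B" using phi_bound by blast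
  have "\<bar>Lphi \<phi> x y y'\<bar> \<le> 4 * B" for y y'
    using B[of "x + y"] B[of "x - y'"] B[of x] unfolding Lphi_def by linarith
  then show ?thesis by (rule that)
qed

text \<open>The second direction enters through x - t y', so the first order terms cancel when y and
  y' have the same component along the gradient. Each of the two points contributes K t^2 to the
  error.\<close>

lemma Lphi_linearization:
  assumes "0 \<le> t" "t \<le> \<eta>" "norm y = 1" "norm y' = 1"
  shows "\<bar>Lphi \<phi> x (t *\<^sub>R y) (t *\<^sub>R y') - t * (G x \<bullet> (y - y'))\<bar> \<le> 2 * K * t\<^sup>2"
  using phi_linearization[OF assms(1,2), of y 0] phi_linearization[OF assms(1,2), of "- y'" 0] assms
  unfolding Lphi_def by (simp add: inner_diff_right abs_le_iff algebra_simps)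

lemma Lphi_tail_PInf:
  assumes "norm y = 1" "norm y' = 1" "0 < G x \<bullet> (y - y')"
  shows "Lim (at_right 0) (\<lambda>\<delta>. ereal (tail_int s \<delta> (\<lambda>t. Lphi \<phi> x (t *\<^sub>R y) (t *\<^sub>R y')))) = \<infinity>"
proof (rule tendsto_Lim)
  let ?g = "\<lambda>t. Lphi \<phi> x (t *\<^sub>R y) (t *\<^sub>R y')"
  obtain B where B: "\<And>y y'. \<bar>Lphi \<phi> x y y'\<bar> \<le> B" using Lphi_bound by blast
  have "filterlim (\<lambda>\<delta>. LINT t:{\<delta><..}|lborel. W t * ?g t) at_top (at_right 0)"
  proof (rule W_tail_at_top[OF _ eta_pos assms(3)])
    show "(G x \<bullet> (y - y')) * t - (2 * K) * t\<^sup>2 \<le> ?g t" if "0 < t" "t \<le> \<eta>" for t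
      using Lphi_linearization[of t y y'] that assms by (simp add: abs_le_iff mult.commute)
  qed (use B K_nonneg in auto)
  then have "filterlim (\<lambda>\<delta>. Cs s * (LINT t:{\<delta><..}|lborel. W t * ?g t)) at_top (at_right 0)"
    by (rule filterlim_tendsto_pos_mult_at_top[OF tendsto_const Cs_pos])
  then have "((\<lambda>\<delta>. ereal (Cs s * (LINT t:{\<delta><..}|lborel. W t * ?g t))) \<longlongrightarrow> \<infinity>) (at_right 0)"
    by (simp add: tendsto_PInfty_eq_at_top)
  moreover have "\<forall>\<^sub>F \<delta> in at_right 0. ereal (Cs s * (LINT t:{\<delta><..}|lborel. W t * ?g t)) = ereal (tail_int s \<delta> ?g)"
    by (auto simp: eventually_at_filter tail_int_eq)
  ultimately show "((\<lambda>\<delta>. ereal (tail_int s \<delta> ?g)) \<longlongrightarrow> \<infinity>) (at_right 0)"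
    by (rule Lim_transform_eventually)
qed simp

lemma Lphi_tail_MInf:
  assumes "norm y = 1" "norm y' = 1" "G x \<bullet> (y - y') < 0"
  shows "Lim (at_right 0) (\<lambda>\<delta>. ereal (tail_int s \<delta> (\<lambda>t. Lphi \<phi> x (t *\<^sub>R y) (t *\<^sub>R y')))) = - \<infinity>"
proof (rule tendsto_Lim)
  let ?g = "\<lambda>t. Lphi \<phi> x (t *\<^sub>R y) (t *\<^sub>R y')"
  obtain B where B: "\<And>y y'. \<bar>Lphi \<phi> x y y'\<bar> \<le> B" using Lphi_bound by blast
  have "filterlim (\<lambda>\<delta>. LINT t:{\<delta><..}|lborel. W t * - ?g t) at_top (at_right 0)"
  proof (rule W_tail_at_top[OF _ eta_pos, where c = "- (G x \<bullet> (y - y'))" and M = "2 * K" and B = B])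
    show "- (G x \<bullet> (y - y')) * t - (2 * K) * t\<^sup>2 \<le> - ?g t" if "0 < t" "t \<le> \<eta>" for t
      using Lphi_linearization[of t y y'] that assms by (simp add: abs_le_iff mult.commute)
  qed (use B K_nonneg assms in auto)
  then have "filterlim (\<lambda>\<delta>. Cs s * (LINT t:{\<delta><..}|lborel. W t * - ?g t)) at_top (at_right 0)"
    by (rule filterlim_tendsto_pos_mult_at_top[OF tendsto_const Cs_pos])
  then have "((\<lambda>\<delta>. ereal (Cs s * (LINT t:{\<delta><..}|lborel. W t * - ?g t))) \<longlongrightarrow> \<infinity>) (at_right 0)"
    by (simp add: tendsto_PInfty_eq_at_top)
  moreover have "\<forall>\<^sub>F \<delta> in at_right 0. ereal (Cs s * (LINT t:{\<delta><..}|lborel. W t * - ?g t)) = - ereal (tail_int s \<delta> ?g)"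
    by (auto simp: eventually_at_filter tail_int_eq set_lebesgue_integral_def)
  ultimately have "((\<lambda>\<delta>. - ereal (tail_int s \<delta> ?g)) \<longlongrightarrow> \<infinity>) (at_right 0)"
    by (rule Lim_transform_eventually)
  then show "((\<lambda>\<delta>. ereal (tail_int s \<delta> ?g)) \<longlongrightarrow> - \<infinity>) (at_right 0)"
    by (subst ereal_Lim_uminus) simp
qed simp

lemma Lphi_taylor:
  assumes \<epsilon>: "0 < \<epsilon>" "\<epsilon> < \<eta>" and t: "0 \<le> t" "t \<le> \<epsilon>"
  shows "\<bar>Lphi \<phi> x (t *\<^sub>R e) (t *\<^sub>R e) - (H x e \<bullet> e) * t\<^sup>2\<bar> \<le> D \<epsilon> * t\<^sup>2"
proof -
  have "\<bar>\<phi> (x + t *\<^sub>R e) - \<phi> x - t * (G x \<bullet> e) - (H x e \<bullet> e) * t\<^sup>2 / 2\<bar> \<le> D \<epsilon> * t\<^sup>2 / 2"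
    using phi_taylor[OF \<epsilon>, of "t *\<^sub>R e"] t
    by (simp add: blinfun.scaleR_right power2_eq_square mult_ac)
  moreover have "\<bar>\<phi> (x - t *\<^sub>R e) - \<phi> x + t * (G x \<bullet> e) - (H x e \<bullet> e) * t\<^sup>2 / 2\<bar> \<le> D \<epsilon> * t\<^sup>2 / 2"
    using phi_taylor[OF \<epsilon>, of "- (t *\<^sub>R e)"] t
    by (simp add: blinfun.scaleR_right blinfun.minus_right power2_eq_square mult_ac)
  ultimately show ?thesis
    unfolding Lphi_def abs_le_iff by linarith
qed

text \<open>Only the direction of the gradient survives in the sup-inf: for any other pair of directions
  the first order term does not cancel and makes the integral diverge at 0, as s > 1/2.\<close>

lemma Ls_eq:
  assumes \<epsilon>: "0 < \<epsilon>" "\<epsilon> < \<eta>"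
  obtains J where "Ls s \<phi> x = ereal (J + tail_int s \<epsilon> (\<lambda>t. Lphi \<phi> x (t *\<^sub>R e) (t *\<^sub>R e)))"
    "\<bar>J - Cs s * (H x e \<bullet> e) * (\<epsilon> powr (2 - 2 * s) / (2 - 2 * s))\<bar>
       \<le> Cs s * D \<epsilon> * (\<epsilon> powr (2 - 2 * s) / (2 - 2 * s))"
proof -
  let ?g = "\<lambda>t. Lphi \<phi> x (t *\<^sub>R e) (t *\<^sub>R e)"
  let ?V = "\<lambda>y y'. Lim (at_right 0) (\<lambda>\<delta>. ereal (tail_int s \<delta> (\<lambda>t. Lphi \<phi> x (t *\<^sub>R y) (t *\<^sub>R y'))))"
  let ?m = "\<epsilon> powr (2 - 2 * s) / (2 - 2 * s)"
  define q where "q = H x e \<bullet> e"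
  obtain B where B: "\<And>y y'. \<bar>Lphi \<phi> x y y'\<bar> \<le> B" using Lphi_bound by blast
  have near: "\<bar>?g t - q * t\<^sup>2\<bar> \<le> D \<epsilon> * t\<^sup>2" if "0 < t" "t \<le> \<epsilon>" for t
    using Lphi_taylor[OF \<epsilon>] that by (simp add: q_def)
  have near': "\<bar>?g t\<bar> \<le> (\<bar>q\<bar> + D \<epsilon>) * t\<^sup>2" if "0 < t" "t \<le> \<epsilon>" for t
  proof -
    have "\<bar>?g t\<bar> \<le> \<bar>?g t - q * t\<^sup>2\<bar> + \<bar>q * t\<^sup>2\<bar>" by linarith
    then show ?thesis using near[OF that] by (simp add: abs_mult algebra_simps)
  qed
  define I where "I = (LINT t:{0<..\<epsilon>}|lborel. W t * ?g t)"
  \<comment> \<open>Only this part, over (0, \<epsilon>], gets estimated. The tail beyond \<epsilon>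
    is kept exact so that it can cancel against the averages.\<close>
  define J where "J = Cs s * I"
  define R where "R = J + tail_int s \<epsilon> ?g"
  have lim: "((\<lambda>\<delta>. LINT t:{\<delta><..}|lborel. W t * ?g t) \<longlongrightarrow> I + (LINT t:{\<epsilon><..}|lborel. W t * ?g t)) (at_right 0)"
    and int: "set_integrable lborel {0<..\<epsilon>} (\<lambda>t. W t * ?g t)"
    unfolding I_def using W_tail_tendsto[OF Lphi_ray_measurable \<epsilon>(1) near' B] by auto
  have "((\<lambda>\<delta>. ereal (Cs s * (LINT t:{\<delta><..}|lborel. W t * ?g t))) \<longlongrightarrow> ereal R) (at_right 0)"
    using tendsto_mult_left[OF lim, of "Cs s"] \<epsilon>
    by (simp add: R_def J_def tail_int_eq algebra_simps)
  moreover have "\<forall>\<^sub>F \<delta> in at_right 0. ereal (Cs s * (LINT t:{\<delta><..}|lborel. W t * ?g t)) = ereal (tail_int s \<delta> ?g)"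
    by (auto simp: eventually_at_filter tail_int_eq)
  ultimately have "((\<lambda>\<delta>. ereal (tail_int s \<delta> ?g)) \<longlongrightarrow> ereal R) (at_right 0)"
    by (rule Lim_transform_eventually)
  then have Vee: "?V e e = ereal R"
    by (intro tendsto_Lim) auto
  have pos: "0 < norm (G x) * (norm (y - e))\<^sup>2 / 2" if "y \<noteq> e" for y
    using px_ne that by simp
  \<comment> \<open>Pairs with one entry e suffice. As e is the only maximizer of the linear form,
    the pair (e, e) is a saddle point: changing the first entry alone gives minus infinity, changing
    the second alone gives infinity.\<close>
  have Vye: "?V y e = - \<infinity>" if "norm y = 1" "y \<noteq> e" for y
    using that pos[of y] G_inner_diff[of y] by (intro Lphi_tail_MInf) auto
  have Vey: "?V e y = \<infinity>" if "norm y = 1" "y \<noteq> e" for y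
    using that pos[of y] G_inner_diff[of y]
    by (intro Lphi_tail_PInf) (auto simp: inner_diff_right)
  have inf_e: "(INF y'\<in>sphere 0 1. ?V e y') = ereal R"
  proof (rule antisym)
    show "(INF y'\<in>sphere 0 1. ?V e y') \<le> ereal R"
      by (rule INF_lower2[of e]) (auto simp: Vee)
    show "ereal R \<le> (INF y'\<in>sphere 0 1. ?V e y')"
    proof (rule INF_greatest)
      fix y' :: 'a assume "y' \<in> sphere 0 1"
      then show "ereal R \<le> ?V e y'" using Vee Vey[of y'] by (cases "y' = e") auto
    qed
  qed
  have "Ls s \<phi> x = ereal R"
    unfolding Ls_def
  proof (rule antisym)
    show "(SUP y\<in>sphere 0 1. INF y'\<in>sphere 0 1. ?V y y') \<le> ereal R"
    proof (rule SUP_least)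
      fix y :: 'a assume y: "y \<in> sphere 0 1"
      show "(INF y'\<in>sphere 0 1. ?V y y') \<le> ereal R"
      proof (cases "y = e")
        case True then show ?thesis using inf_e by simp
      next
        case False
        then have "?V y e = - \<infinity>" using Vye y by simp
        then show ?thesis by (intro INF_lower2[of e]) auto
      qed
    qed
    show "ereal R \<le> (SUP y\<in>sphere 0 1. INF y'\<in>sphere 0 1. ?V y y')"
      by (rule SUP_upper2[of e]) (auto simp: inf_e)
  qed
  moreover have "\<bar>I - q * ?m\<bar> \<le> D \<epsilon> * ?m"
  proof -
    note m = W_t2_Ioc_0[OF \<epsilon>(1)]
    have "W t * ?g t \<le> (q + D \<epsilon>) * (W t * t\<^sup>2) \<and> (q - D \<epsilon>) * (W t * t\<^sup>2) \<le> W t * ?g t"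
      if "t \<in> {0<..\<epsilon>}" for t
    proof -
      have "?g t \<le> (q + D \<epsilon>) * t\<^sup>2" "(q - D \<epsilon>) * t\<^sup>2 \<le> ?g t"
        using near[of t] that by (auto simp: abs_le_iff algebra_simps)
      from this[THEN mult_left_mono, OF W_nonneg[of t]] show ?thesis
        by (simp add: mult_ac)
    qed
    then have "I \<le> (LINT t:{0<..\<epsilon>}|lborel. (q + D \<epsilon>) * (W t * t\<^sup>2))"
      "(LINT t:{0<..\<epsilon>}|lborel. (q - D \<epsilon>) * (W t * t\<^sup>2)) \<le> I"
      unfolding I_def by (intro set_integral_mono int set_integrable_mult_right m(1); blast)+
    then have "I \<le> (q + D \<epsilon>) * ?m" "(q - D \<epsilon>) * ?m \<le> I"
      unfolding set_integral_mult_right m(2) .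
    moreover have "\<bar>I - q * c\<bar> \<le> D \<epsilon> * c" if "I \<le> (q + D \<epsilon>) * c" "(q - D \<epsilon>) * c \<le> I" for c
      using that by (simp add: abs_le_iff algebra_simps)
    ultimately show ?thesis by blast
  qed
  then have CI: "Cs s * \<bar>I - q * ?m\<bar> \<le> Cs s * (D \<epsilon> * ?m)"
    using Cs_pos by (intro mult_left_mono) auto
  have "\<bar>J - Cs s * q * ?m\<bar> \<le> Cs s * D \<epsilon> * ?m"
  proof -
    have "J - Cs s * q * c = Cs s * (I - q * c)" for c
      unfolding J_def by (simp add: algebra_simps)
    then show ?thesis
      using Cs_pos CI by (simp only: abs_mult abs_of_pos mult.assoc)
  qed
  ultimately show ?thesis
    by (intro that[of J]) (simp_all add: R_def q_def)
qed

subsection \<open>Averages over rays\<close>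

text \<open>The average in direction y up to the factor 2 s \<epsilon>^(2s), which is the same for
  all directions.\<close>

definition F :: "real \<Rightarrow> 'a \<Rightarrow> real" where
  "F \<epsilon> y = (LINT t:{\<epsilon><..}|lborel. W t * \<phi> (x + t *\<^sub>R y))"

text \<open>\<open>near1\<close> and \<open>near2\<close> are the integrals of t and t^2 against the
  weight over (\<epsilon>, \<eta>], and \<open>far\<close> is that of 1 + t over (\<eta>,
  \<infinity>). They multiply the gradient, Hessian and modulus terms respectively.\<close>

definition near1 :: "real \<Rightarrow> real" where
  "near1 \<epsilon> = (\<epsilon> powr (1 - 2 * s) - \<eta> powr (1 - 2 * s)) / (2 * s - 1)"

definition near2 :: "real \<Rightarrow> real" where
  "near2 \<epsilon> = (\<eta> powr (2 - 2 * s) - \<epsilon> powr (2 - 2 * s)) / (2 - 2 * s)"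

definition far :: real where
  "far = \<eta> powr (- 2 * s) / (2 * s) + \<eta> powr (1 - 2 * s) / (2 * s - 1)"

definition A :: "real \<Rightarrow> real" where
  "A \<epsilon> = Acoef s ((1/2) * K) (omega \<phi> x \<eta>) (norm (G x)) \<eta> \<epsilon>"

lemma near1_pos: "0 < \<epsilon> \<Longrightarrow> \<epsilon> < \<eta> \<Longrightarrow> 0 < near1 \<epsilon>"
  unfolding near1_def using s_gt by (simp add: powr_less_mono2_neg)

lemma near2_pos: "0 < \<epsilon> \<Longrightarrow> \<epsilon> < \<eta> \<Longrightarrow> 0 < near2 \<epsilon>"
  unfolding near2_def using s_lt by (simp add: powr_less_mono2)

lemma far_pos: "0 < far"
  unfolding far_def using s_gt eta_pos by (intro add_pos_pos divide_pos_pos) auto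

lemma ray_integrable:
  assumes "0 < a"
  shows "set_integrable lborel {a<..} (\<lambda>t. W t * \<phi> (x + t *\<^sub>R y))"
proof -
  obtain B where "\<And>z. \<bar>\<phi> z\<bar> \<le> B" using phi_bound by blast
  then show ?thesis by (intro W_bounded_Ioi_integrable[OF _ assms]) auto
qed

text \<open>The cut at \<eta> separates the region of differentiability, handled by
  \<open>phi_linearization\<close>, from the region where only the modulus is available, handled by
  \<open>sphere_diff_le_omega\<close>.\<close>

lemma F_diff_le:
  assumes \<epsilon>: "0 < \<epsilon>" "\<epsilon> < \<eta>" and dim: "2 \<le> DIM('a)" and y: "norm y = 1"
  defines "a \<equiv> norm (y - e)"
  shows "F \<epsilon> y - F \<epsilon> e \<le> - (norm (G x) * a\<^sup>2 / 2) * near1 \<epsilon> + K * a * near2 \<epsilon> + 2 * omega \<phi> x \<eta> a * far"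
proof -
  let ?d = "\<lambda>t. W t * (\<phi> (x + t *\<^sub>R y) - \<phi> (x + t *\<^sub>R e))"
  define w where "w = omega \<phi> x \<eta> a"
  have int: "set_integrable lborel {\<epsilon><..} ?d"
    using set_integral_diff(1)[OF ray_integrable[OF \<epsilon>(1), of y] ray_integrable[OF \<epsilon>(1), of e]]
    by (simp add: right_diff_distrib)
  then have i1: "set_integrable lborel {\<epsilon><..\<eta>} ?d" and i2: "set_integrable lborel {\<eta><..} ?d"
    using \<epsilon> by (auto intro: set_integrable_subset)
  have "F \<epsilon> y - F \<epsilon> e = (LINT t:{\<epsilon><..}|lborel. ?d t)"
    using set_integral_diff(2)[OF ray_integrable[OF \<epsilon>(1), of y] ray_integrable[OF \<epsilon>(1), of e]]
    by (simp add: F_def right_diff_distrib)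
  also have "\<dots> = (LINT t:{\<epsilon><..\<eta>}|lborel. ?d t) + (LINT t:{\<eta><..}|lborel. ?d t)"
    using set_integral_Ioi_split[OF _ i1 i2] \<epsilon> by simp
  also have "(LINT t:{\<epsilon><..\<eta>}|lborel. ?d t) \<le> - (norm (G x) * a\<^sup>2 / 2) * near1 \<epsilon> + K * a * near2 \<epsilon>"
  proof -
    have j1: "set_integrable lborel {\<epsilon><..\<eta>} (\<lambda>t. - (norm (G x) * a\<^sup>2 / 2) * (W t * t))"
      and j2: "set_integrable lborel {\<epsilon><..\<eta>} (\<lambda>t. K * a * (W t * t\<^sup>2))"
      using W_t_Ioc(1)[of \<epsilon> \<eta>] W_t2_Ioc(1)[of \<epsilon> \<eta>] \<epsilon> by (intro set_integrable_mult_right; simp)+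
    have "(LINT t:{\<epsilon><..\<eta>}|lborel. ?d t)
        \<le> (LINT t:{\<epsilon><..\<eta>}|lborel. - (norm (G x) * a\<^sup>2 / 2) * (W t * t) + K * a * (W t * t\<^sup>2))"
    proof (intro set_integral_mono i1 set_integral_add(1) j1 j2)
      fix t assume t: "t \<in> {\<epsilon><..\<eta>}"
      have "\<phi> (x + t *\<^sub>R y) - \<phi> (x + t *\<^sub>R e) \<le> t * (G x \<bullet> (y - e)) + K * a * t\<^sup>2"
        using phi_linearization[of t y e] t \<epsilon> y unfolding a_def by (auto simp: abs_le_iff)
      also have "t * (G x \<bullet> (y - e)) = - (norm (G x) * a\<^sup>2 / 2) * t"
        unfolding G_inner_diff[OF y] a_def by simp
      finally show "?d t \<le> - (norm (G x) * a\<^sup>2 / 2) * (W t * t) + K * a * (W t * t\<^sup>2)"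
        using mult_left_mono[OF _ W_nonneg[of t]] by (fastforce simp: algebra_simps)
    qed
    also have "\<dots> = - (norm (G x) * a\<^sup>2 / 2) * near1 \<epsilon> + K * a * near2 \<epsilon>"
      unfolding set_integral_add(2)[OF j1 j2] set_integral_mult_right near1_def near2_def
      using W_t_Ioc(2)[of \<epsilon> \<eta>] W_t2_Ioc(2)[of \<epsilon> \<eta>] \<epsilon> by simp
    finally show ?thesis .
  qed
  also have "(LINT t:{\<eta><..}|lborel. ?d t) \<le> 2 * w * far"
  proof -
    have j1: "set_integrable lborel {\<eta><..} (\<lambda>t. 2 * w * W t)"
      and j2: "set_integrable lborel {\<eta><..} (\<lambda>t. 2 * w * (W t * t))"
      using W_Ioi(1)[OF eta_pos] W_t_Ioi(1)[OF eta_pos] by (intro set_integrable_mult_right; simp)+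
    have "(LINT t:{\<eta><..}|lborel. ?d t) \<le> (LINT t:{\<eta><..}|lborel. 2 * w * W t + 2 * w * (W t * t))"
    proof (intro set_integral_mono i2 set_integral_add(1) j1 j2)
      fix t assume t: "t \<in> {\<eta><..}"
      have "\<phi> (x + t *\<^sub>R y) - \<phi> (x + t *\<^sub>R e) \<le> 2 * (1 + t) * w"
        using sphere_diff_le_omega[OF phi_bdd dim y norm_e eta_pos, of t x] t
        unfolding a_def w_def by auto
      then show "?d t \<le> 2 * w * W t + 2 * w * (W t * t)"
        using mult_left_mono[OF _ W_nonneg[of t]] by (fastforce simp: algebra_simps)
    qed
    also have "\<dots> = 2 * w * far"
      unfolding set_integral_add(2)[OF j1 j2] set_integral_mult_right far_def
      using W_Ioi(2)[OF eta_pos] W_t_Ioi(2)[OF eta_pos] by (simp add: distrib_left)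
    finally show ?thesis .
  qed
  finally show ?thesis by (simp add: w_def)
qed

text \<open>Beyond a supremum the defining inequality fails, and its negation, cleared of
  denominators, is the second claim. Arguments up to 2 are enough because a will be the distance of
  two unit vectors.\<close>

lemma kappa_bounds:
  assumes "0 < \<epsilon>" "\<epsilon> < \<eta>"
  defines "k \<equiv> kappa s (omega \<phi> x \<eta>) (norm (G x)) \<eta> \<epsilon>"
  shows "0 \<le> k"
    and "\<And>a. k < a \<Longrightarrow> a \<le> 2 \<Longrightarrow> omega \<phi> x \<eta> a * far \<le> norm (G x) * near1 \<epsilon> * a\<^sup>2 / 8"
proof -
  let ?S = "{a\<in>{0..2}. a\<^sup>2 \<le> 8 * omega \<phi> x \<eta> a / norm (G x) *
      (((2 * s - 1) / (2 * s) * \<eta> powr (- 2 * s) + \<eta> powr (1 - 2 * s)) / (\<epsilon> powr (1 - 2 * s) - \<eta> powr (1 - 2 * s)))}"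
  have n1: "0 < near1 \<epsilon>" and p: "0 < norm (G x)"
    using near1_pos assms px_ne by auto
  \<comment> \<open>Numerator and denominator are \<open>far\<close> and
    \<open>near1 \<epsilon>\<close>, both multiplied by 2 s - 1.\<close>
  have c: "((2 * s - 1) / (2 * s) * \<eta> powr (- 2 * s) + \<eta> powr (1 - 2 * s)) / (\<epsilon> powr (1 - 2 * s) - \<eta> powr (1 - 2 * s))
      = far / near1 \<epsilon>"
  proof -
    have "((2 * s - 1) / (2 * s) * \<eta> powr (- 2 * s) + \<eta> powr (1 - 2 * s)) = (2 * s - 1) * far"
      unfolding far_def using s_gt by (simp add: distrib_left)
    moreover have "(\<epsilon> powr (1 - 2 * s) - \<eta> powr (1 - 2 * s)) = (2 * s - 1) * near1 \<epsilon>"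
      unfolding near1_def using s_gt by simp
    ultimately show ?thesis using s_gt by simp
  qed
  have bdd: "bdd_above ?S" by (intro bdd_aboveI[of _ 2]) auto
  have "0 \<in> ?S"
    unfolding c using omega_nonneg[OF phi_bdd, of 0] n1 p far_pos by simp
  then show "0 \<le> k"
    unfolding k_def kappa_def by (intro cSup_upper[OF _ bdd]) simp
  fix a assume a: "k < a" "a \<le> 2"
  have "a \<notin> ?S"
    using cSup_upper[OF _ bdd, of a] a unfolding k_def kappa_def by linarith
  then have "8 * omega \<phi> x \<eta> a / norm (G x) * (far / near1 \<epsilon>) < a\<^sup>2"
    unfolding c using a \<open>0 \<le> k\<close> by auto
  then show "omega \<phi> x \<eta> a * far \<le> norm (G x) * near1 \<epsilon> * a\<^sup>2 / 8"
    using n1 p by (simp add: field_simps)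
qed

lemma A_bounds:
  assumes \<epsilon>: "0 < \<epsilon>" "\<epsilon> < \<eta>"
  shows "0 \<le> A \<epsilon>"
    and "\<And>a. A \<epsilon> < a \<Longrightarrow> a \<le> 2 \<Longrightarrow> omega \<phi> x \<eta> a * far \<le> norm (G x) * near1 \<epsilon> * a\<^sup>2 / 8"
    and "\<And>a. A \<epsilon> < a \<Longrightarrow> K * a * near2 \<epsilon> \<le> norm (G x) * near1 \<epsilon> * a\<^sup>2 / 16"
proof -
  have n1: "0 < near1 \<epsilon>" and p: "0 < norm (G x)"
    using near1_pos \<epsilon> px_ne by auto
  \<comment> \<open>C_x contributes K / 2 and the quotient of the power differences contributes 2 (1
    - s) / (2 s - 1), so all factors depending on s alone cancel.\<close>
  have c: "16 * ((1/2) * K) / norm (G x) * ((2 * s - 1) / (1 - s)) * ((\<eta> powr (2 - 2 * s) - \<epsilon> powr (2 - 2 * s)) / (\<epsilon> powr (1 - 2 * s) - \<eta> powr (1 - 2 * s)))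
    = 16 * K * near2 \<epsilon> / (norm (G x) * near1 \<epsilon>)"
  proof -
    have gen: "16 * ((1/2) * K) / norm (G x) * (v / u) * (2 * u * near2 \<epsilon> / (v * near1 \<epsilon>))
        = 16 * K * near2 \<epsilon> / (norm (G x) * near1 \<epsilon>)" if "u \<noteq> 0" "v \<noteq> 0" for u v
      using that by simp
    have eq1: "\<eta> powr (2 - 2 * s) - \<epsilon> powr (2 - 2 * s) = 2 * (1 - s) * near2 \<epsilon>"
      unfolding near2_def using s_lt by simp
    have eq2: "\<epsilon> powr (1 - 2 * s) - \<eta> powr (1 - 2 * s) = (2 * s - 1) * near1 \<epsilon>"
      unfolding near1_def using s_gt by simp
    show ?thesis unfolding eq1 eq2 by (rule gen) (use s_gt s_lt in auto)
  qed
  have A_eq: "A \<epsilon> = max (16 * K * near2 \<epsilon> / (norm (G x) * near1 \<epsilon>)) (kappa s (omega \<phi> x \<eta>) (norm (G x)) \<eta> \<epsilon>)"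
    unfolding A_def Acoef_def c ..
  show A0: "0 \<le> A \<epsilon>" using kappa_bounds(1)[OF \<epsilon>] unfolding A_eq by simp
  show "omega \<phi> x \<eta> a * far \<le> norm (G x) * near1 \<epsilon> * a\<^sup>2 / 8" if "A \<epsilon> < a" "a \<le> 2" for a
    using that kappa_bounds(2)[OF \<epsilon>, of a] unfolding A_eq by simp
  show "K * a * near2 \<epsilon> \<le> norm (G x) * near1 \<epsilon> * a\<^sup>2 / 16" if "A \<epsilon> < a" for a
  proof -
    have "16 * K * near2 \<epsilon> / (norm (G x) * near1 \<epsilon>) \<le> a" using that unfolding A_eq by simp
    then have "16 * K * near2 \<epsilon> \<le> a * (norm (G x) * near1 \<epsilon>)"
      using n1 p by (simp add: pos_divide_le_eq)
    then have "a * (16 * K * near2 \<epsilon>) \<le> a * (a * (norm (G x) * near1 \<epsilon>))"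
      using that A0 by (intro mult_left_mono) auto
    then show ?thesis by (simp add: power2_eq_square algebra_simps)
  qed
qed

text \<open>Chosen so that (1 - s) s \<epsilon>^(2s) times it is exactly the first term of the
  asserted bound.\<close>

definition E :: "real \<Rightarrow> real" where
  "E \<epsilon> = 2 * (2 * K * near2 \<epsilon> * A \<epsilon> + far * omega \<phi> x \<eta> (A \<epsilon>))"

lemma E_nonneg:
  assumes "0 < \<epsilon>" "\<epsilon> < \<eta>"
  shows "0 \<le> E \<epsilon>"
  unfolding E_def using K_nonneg near2_pos[OF assms] A_bounds(1)[OF assms] far_pos
    omega_nonneg[OF phi_bdd A_bounds(1)[OF assms]]
  by (intro mult_nonneg_nonneg add_nonneg_nonneg) auto

lemma F_le:
  assumes \<epsilon>: "0 < \<epsilon>" "\<epsilon> < \<eta>" and dim: "2 \<le> DIM('a)" and y: "norm y = 1"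
  shows "F \<epsilon> y \<le> F \<epsilon> e + E \<epsilon>"
proof -
  define a where "a = norm (y - e)"
  define w where "w = omega \<phi> x \<eta>"
  have a: "0 \<le> a" "a \<le> 2"
    using norm_triangle_ineq4[of y e] y by (auto simp: a_def)
  have diff: "F \<epsilon> y - F \<epsilon> e \<le> - (norm (G x) * near1 \<epsilon> * a\<^sup>2 / 2) + K * a * near2 \<epsilon> + 2 * (w a * far)"
    using F_diff_le[OF \<epsilon> dim y] unfolding a_def w_def by (simp add: mult_ac)
  have pos: "0 \<le> norm (G x) * near1 \<epsilon> * a\<^sup>2"
    using near1_pos[OF \<epsilon>] by simp
  show ?thesis
  proof (cases "A \<epsilon> < a")
    case True
    \<comment> \<open>In units of \<open>norm (G x) * near1 \<epsilon> * a\<^sup>2\<close> the gain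
      is 1/2, and the losses are at most 1/16 from the Hessian and 2/8 from the modulus.\<close>
    then have "F \<epsilon> y - F \<epsilon> e \<le> 0"
      using diff A_bounds(2,3)[OF \<epsilon>, of a] a pos unfolding w_def by linarith
    then show ?thesis using E_nonneg[OF \<epsilon>] by linarith
  next
    case False
    then have "w a * far \<le> w (A \<epsilon>) * far"
      unfolding w_def using far_pos a by (intro mult_right_mono omega_mono phi_bdd) auto
    moreover have "K * a * near2 \<epsilon> \<le> K * A \<epsilon> * near2 \<epsilon>"
      using False K_nonneg near2_pos[OF \<epsilon>] by (intro mult_right_mono mult_left_mono) auto
    moreover have "0 \<le> K * A \<epsilon> * near2 \<epsilon>"
      using K_nonneg near2_pos[OF \<epsilon>] A_bounds(1)[OF \<epsilon>] by (intro mult_nonneg_nonneg) auto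
    moreover have "E \<epsilon> = 4 * (K * A \<epsilon> * near2 \<epsilon>) + 2 * (w (A \<epsilon>) * far)"
      unfolding E_def w_def by simp
    ultimately show ?thesis using diff pos by linarith
  qed
qed

subsection \<open>Sup and inf over the small ball\<close>

text \<open>Write v = \<epsilon> e + d. The constraint |v| <= \<epsilon> forces the linear part to
  drop by at least p |d|^2 / (2 \<epsilon>), while the quadratic part rises by at most \<epsilon> h
  |d|. The largest possible net rise is the cubic term.\<close>

lemma quadratic_le:
  assumes "0 < \<epsilon>" and v: "norm v \<le> \<epsilon>"
  shows "G x \<bullet> v + (H x v \<bullet> v) / 2
    \<le> \<epsilon> * norm (G x) + \<epsilon>\<^sup>2 * (H x e \<bullet> e) / 2 + \<epsilon> ^ 3 * (norm (H x))\<^sup>2 / (2 * norm (G x))"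
proof -
  define p h where "p = norm (G x)" and "h = norm (H x)"
  define w d where "w = \<epsilon> *\<^sub>R e" and "d = v - w"
  have p: "0 < p" using px_ne by (simp add: p_def)
  have w: "norm w = \<epsilon>" using assms by (simp add: w_def)
  have ee: "e \<bullet> e = 1" by (simp add: dot_square_norm)
  have Gd: "G x \<bullet> d = p * (e \<bullet> v - \<epsilon>)"
    by (subst G_eq) (simp add: d_def w_def p_def inner_diff_right ee algebra_simps)
  have "(norm d)\<^sup>2 = (norm v)\<^sup>2 - 2 * \<epsilon> * (e \<bullet> v) + \<epsilon>\<^sup>2"
    unfolding power2_norm_eq_inner d_def w_def
    by (simp add: inner_diff_left inner_diff_right ee inner_commute power2_eq_square)
  also have "\<dots> \<le> 2 * \<epsilon> * (\<epsilon> - e \<bullet> v)"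
    using power_mono[OF v, of 2] by (simp add: algebra_simps power2_eq_square)
  finally have "p * (norm d)\<^sup>2 \<le> p * (2 * \<epsilon> * (\<epsilon> - e \<bullet> v))"
    using p by (intro mult_left_mono) auto
  also have "\<dots> = - (G x \<bullet> d) * (2 * \<epsilon>)"
    by (simp add: Gd algebra_simps)
  finally have 1: "G x \<bullet> d \<le> - (p * (norm d)\<^sup>2 / (2 * \<epsilon>))"
    using assms by (simp add: field_simps)
  have H_le: "H x a \<bullet> b \<le> h * norm a * norm b" for a b
  proof -
    have "H x a \<bullet> b \<le> norm (H x a) * norm b" by (rule norm_cauchy_schwarz)
    also have "\<dots> \<le> h * norm a * norm b"
      unfolding h_def by (intro mult_right_mono norm_blinfun) auto
    finally show ?thesis .
  qed
  have "H x v \<bullet> v - H x w \<bullet> w = H x d \<bullet> v + H x w \<bullet> d"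
    by (simp add: d_def blinfun.diff_right inner_diff_left inner_diff_right)
  also have "\<dots> \<le> h * norm d * \<epsilon> + h * \<epsilon> * norm d"
  proof (rule add_mono)
    have "h * norm d * norm v \<le> h * norm d * \<epsilon>"
      using v by (intro mult_left_mono) (auto simp: h_def)
    then show "H x d \<bullet> v \<le> h * norm d * \<epsilon>" using H_le[of d v] by linarith
    show "H x w \<bullet> d \<le> h * \<epsilon> * norm d" using H_le[of w d] w by simp
  qed
  finally have 2: "(H x v \<bullet> v) / 2 - (H x w \<bullet> w) / 2 \<le> \<epsilon> * h * norm d"
    by (simp add: mult_ac)
  \<comment> \<open>Completes the square in |d|; the maximum of the net rise is attained at |d| =
    \<epsilon>^2 h / p.\<close>
  have "0 \<le> (p * norm d - \<epsilon>\<^sup>2 * h)\<^sup>2 / (2 * \<epsilon> * p)"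
    using p assms by simp
  also have "\<dots> = p * (norm d)\<^sup>2 / (2 * \<epsilon>) - \<epsilon> * h * norm d + \<epsilon> ^ 3 * h\<^sup>2 / (2 * p)"
    using p assms by (simp add: field_simps power2_eq_square power3_eq_cube)
  finally have "G x \<bullet> d + (H x v \<bullet> v) / 2 - (H x w \<bullet> w) / 2 \<le> \<epsilon> ^ 3 * h\<^sup>2 / (2 * p)"
    using 1 2 by linarith
  moreover have "G x \<bullet> d = G x \<bullet> v - \<epsilon> * p"
    by (simp add: d_def w_def inner_diff_right G_inner_e p_def)
  moreover have "H x w \<bullet> w = \<epsilon>\<^sup>2 * (H x e \<bullet> e)"
    by (simp add: w_def blinfun.scaleR_right power2_eq_square)
  ultimately show ?thesis by (simp add: p_def h_def)
qed

lemma sup_ball_estimate: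
  assumes \<epsilon>: "0 < \<epsilon>" "\<epsilon> < \<eta>"
  shows "\<bar>(SUP z\<in>ball x \<epsilon>. \<phi> z) - (\<phi> x + \<epsilon> * norm (G x) + \<epsilon>\<^sup>2 * (H x e \<bullet> e) / 2)\<bar>
    \<le> \<epsilon> ^ 3 * (norm (H x))\<^sup>2 / (2 * norm (G x)) + D \<epsilon> * \<epsilon>\<^sup>2 / 2"
proof -
  let ?S = "SUP z\<in>ball x \<epsilon>. \<phi> z"
  obtain B where B: "\<And>z. \<bar>\<phi> z\<bar> \<le> B" using phi_bound by blast
  have bdd: "bdd_above (\<phi> ` ball x \<epsilon>)"
    using B by (intro bdd_aboveI2[of _ _ B]) (auto simp: abs_le_iff)
  have "?S \<le> \<phi> x + (\<epsilon> * norm (G x) + \<epsilon>\<^sup>2 * (H x e \<bullet> e) / 2 + \<epsilon> ^ 3 * (norm (H x))\<^sup>2 / (2 * norm (G x)))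
      + D \<epsilon> * \<epsilon>\<^sup>2 / 2"
  proof (rule cSUP_least)
    fix z assume "z \<in> ball x \<epsilon>"
    then have v: "norm (z - x) \<le> \<epsilon>" by (simp add: dist_norm norm_minus_commute)
    have "D \<epsilon> / 2 * (norm (z - x))\<^sup>2 \<le> D \<epsilon> / 2 * \<epsilon>\<^sup>2"
      using D_nonneg[of \<epsilon>] \<epsilon> v by (intro mult_left_mono power_mono) auto
    then show "\<phi> z \<le> \<phi> x + (\<epsilon> * norm (G x) + \<epsilon>\<^sup>2 * (H x e \<bullet> e) / 2 + \<epsilon> ^ 3 * (norm (H x))\<^sup>2 / (2 * norm (G x)))
      + D \<epsilon> * \<epsilon>\<^sup>2 / 2"
      using phi_taylor[OF \<epsilon> v] quadratic_le[OF \<epsilon>(1) v] unfolding abs_le_iff by simp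
  qed (use \<epsilon> in auto)
  \<comment> \<open>The near-optimal point x + \<epsilon> e lies on the boundary of the open ball,
    so it is compared with the supremum by continuity.\<close>
  moreover have "\<phi> (x + \<epsilon> *\<^sub>R e) \<le> ?S"
  proof (rule continuous_le_on_closure[of "ball x \<epsilon>"])
    have "continuous_on (cball x \<eta>) \<phi>"
      using grad by (intro has_derivative_continuous_on)
    then show "continuous_on (closure (ball x \<epsilon>)) \<phi>"
      using \<epsilon> by (auto intro: continuous_on_subset)
    show "x + \<epsilon> *\<^sub>R e \<in> closure (ball x \<epsilon>)" using \<epsilon> by (simp add: dist_norm)
    show "\<phi> z \<le> ?S" if "z \<in> ball x \<epsilon>" for z
      using that bdd by (rule cSUP_upper)
  qed
  moreover have "\<bar>\<phi> (x + \<epsilon> *\<^sub>R e) - \<phi> x - \<epsilon> * norm (G x) - \<epsilon>\<^sup>2 * (H x e \<bullet> e) / 2\<bar> \<le> D \<epsilon> * \<epsilon>\<^sup>2 / 2"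
    using phi_taylor[OF \<epsilon>, of "\<epsilon> *\<^sub>R e"] \<epsilon>
    by (simp add: blinfun.scaleR_right G_inner_e power2_eq_square mult.assoc)
  moreover have "0 \<le> \<epsilon> ^ 3 * (norm (H x))\<^sup>2 / (2 * norm (G x))"
    using \<epsilon> by simp
  ultimately show ?thesis unfolding abs_le_iff by linarith
qed

section \<open>Suprema of the averages over directions\<close>

definition Av :: "real \<Rightarrow> 'a \<Rightarrow> real" where
  "Av \<epsilon> y = tail_avg s \<epsilon> (\<lambda>t. \<phi> (x + t *\<^sub>R y))"

lemma Av_eq:
  assumes "0 < \<epsilon>"
  shows "Av \<epsilon> y = 2 * s * \<epsilon> powr (2 * s) * F \<epsilon> y"
  unfolding Av_def tail_avg_def measure_mus_Ioi[OF assms] F_def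
  using assms Cs_pos s_gt by (simp add: tail_int_eq powr_minus_divide)

text \<open>Boundedness over all directions is what makes the real supremum in \<open>Ao\<close> an
  actual upper bound.\<close>

lemma Av_bound: assumes "0 < \<epsilon>" obtains B where "\<And>y. \<bar>Av \<epsilon> y\<bar> \<le> B"
proof -
  obtain B where B: "\<And>z. \<bar>\<phi> z\<bar> \<le> B" using phi_bound by blast
  have "\<bar>F \<epsilon> y\<bar> \<le> (LINT t:{\<epsilon><..}|lborel. B * W t)" for y
  proof -
    have "\<bar>F \<epsilon> y\<bar> \<le> (LINT t:{\<epsilon><..}|lborel. \<bar>W t * \<phi> (x + t *\<^sub>R y)\<bar>)"
      using set_integral_norm_bound[OF ray_integrable[OF assms, of y]] by (simp add: F_def)
    also have "\<dots> \<le> (LINT t:{\<epsilon><..}|lborel. B * W t)"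
      using W_Ioi(1)[OF assms] mult_right_mono[OF B W_nonneg]
      by (intro set_integral_mono set_integrable_abs ray_integrable assms)
        (auto simp: abs_mult W_nonneg mult.commute[of "W _"])
    finally show ?thesis .
  qed
  then have "2 * s * \<epsilon> powr (2 * s) * \<bar>F \<epsilon> y\<bar> \<le> 2 * s * \<epsilon> powr (2 * s) * (LINT t:{\<epsilon><..}|lborel. B * W t)" for y
    using s_gt by (intro mult_left_mono) auto
  then have "\<bar>Av \<epsilon> y\<bar> \<le> 2 * s * \<epsilon> powr (2 * s) * (LINT t:{\<epsilon><..}|lborel. B * W t)" for y
    unfolding Av_eq[OF assms] using s_gt by (simp add: abs_mult)
  then show ?thesis by (rule that)
qed

lemma sup_Av_bounds:
  assumes \<epsilon>: "0 < \<epsilon>" "\<epsilon> < \<eta>" and dim: "2 \<le> DIM('a)"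
  shows "Av \<epsilon> e \<le> (SUP y\<in>sphere 0 1. Av \<epsilon> y)"
    and "(SUP y\<in>sphere 0 1. Av \<epsilon> y) \<le> Av \<epsilon> e + 2 * s * \<epsilon> powr (2 * s) * E \<epsilon>"
proof -
  obtain B where B: "\<And>y. \<bar>Av \<epsilon> y\<bar> \<le> B" using Av_bound[OF \<epsilon>(1)] by blast
  show "Av \<epsilon> e \<le> (SUP y\<in>sphere 0 1. Av \<epsilon> y)"
    using B by (intro cSUP_upper bdd_aboveI2[of _ _ B]) (auto simp: abs_le_iff)
  show "(SUP y\<in>sphere 0 1. Av \<epsilon> y) \<le> Av \<epsilon> e + 2 * s * \<epsilon> powr (2 * s) * E \<epsilon>"
  proof (rule cSUP_least)
    have "e \<in> sphere 0 1" by simp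
    then show "sphere 0 1 \<noteq> ({} :: 'a set)" by blast
    fix y :: 'a assume "y \<in> sphere 0 1"
    then have "2 * s * \<epsilon> powr (2 * s) * F \<epsilon> y \<le> 2 * s * \<epsilon> powr (2 * s) * (F \<epsilon> e + E \<epsilon>)"
      using F_le[OF \<epsilon> dim] s_gt by (intro mult_left_mono) auto
    then show "Av \<epsilon> y \<le> Av \<epsilon> e + 2 * s * \<epsilon> powr (2 * s) * E \<epsilon>"
      unfolding Av_eq[OF \<epsilon>(1)] by (simp add: distrib_left)
  qed
qed

section \<open>Infima, by passing to -\<phi>\<close>

interpretation neg: nonlocal_data s "\<lambda>z. - \<phi> z" x \<eta> "\<lambda>z. - G z" "\<lambda>z. - H z"
  by (rule nonlocal_data_uminus)

lemma neg_e: "neg.e = - e"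
  by (simp add: neg.e_def e_def)

lemma neg_D: "neg.D = D"
  by (simp add: neg.D_def D_def fun_eq_iff norm_minus_commute)

lemma neg_E: "neg.E = E"
proof -
  have "omega (\<lambda>z. - \<phi> z) x \<eta> = omega \<phi> x \<eta>"
    by (simp add: omega_def fun_eq_iff abs_minus_commute)
  then show ?thesis
    by (intro ext) (simp add: neg.E_def E_def neg.K_def K_def neg.near2_def near2_def neg.A_def A_def
        neg.far_def far_def)
qed

lemma neg_Av: "neg.Av \<epsilon> y = - Av \<epsilon> y"
  by (simp add: neg.Av_def Av_def tail_avg_def tail_int_def set_lebesgue_integral_def)

lemma inf_ball_estimate:
  assumes \<epsilon>: "0 < \<epsilon>" "\<epsilon> < \<eta>"
  shows "\<bar>(INF z\<in>ball x \<epsilon>. \<phi> z) - (\<phi> x - \<epsilon> * norm (G x) + \<epsilon>\<^sup>2 * (H x e \<bullet> e) / 2)\<bar>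
    \<le> \<epsilon> ^ 3 * (norm (H x))\<^sup>2 / (2 * norm (G x)) + D \<epsilon> * \<epsilon>\<^sup>2 / 2"
  using neg.sup_ball_estimate[OF \<epsilon>] unfolding INF_real_uminus neg_D neg_e
  by (simp add: blinfun.minus_left blinfun.minus_right abs_le_iff algebra_simps)

lemma inf_Av_bounds:
  assumes \<epsilon>: "0 < \<epsilon>" "\<epsilon> < \<eta>" and dim: "2 \<le> DIM('a)"
  shows "(INF y\<in>sphere 0 1. Av \<epsilon> y) \<le> Av \<epsilon> (- e)"
    and "Av \<epsilon> (- e) - 2 * s * \<epsilon> powr (2 * s) * E \<epsilon> \<le> (INF y\<in>sphere 0 1. Av \<epsilon> y)"
  using neg.sup_Av_bounds[OF \<epsilon> dim] unfolding INF_real_uminus neg_E neg_e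
  by (simp_all add: neg_Av)

text \<open>The error of the sup is nonnegative and that of the inf nonpositive, so their sum is bounded by
  the larger of the two. This gains the factor 2 lost to the arc in \<open>sphere_diff_le_omega\<close>.\<close>

lemma Ao_estimate:
  assumes \<epsilon>: "0 < \<epsilon>" "\<epsilon> < \<eta>"
  shows "\<bar>Ao s \<epsilon> \<phi> x - (Av \<epsilon> e + Av \<epsilon> (- e)) / 2\<bar> \<le> s * \<epsilon> powr (2 * s) * E \<epsilon>"
proof (cases "2 \<le> DIM('a)")
  case True
  have "Ao s \<epsilon> \<phi> x = ((SUP y\<in>sphere 0 1. Av \<epsilon> y) + (INF y\<in>sphere 0 1. Av \<epsilon> y)) / 2"
    by (simp add: Ao_def Av_def)
  then show ?thesis
    using sup_Av_bounds[OF \<epsilon> True] inf_Av_bounds[OF \<epsilon> True]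
    unfolding abs_le_iff by (simp add: field_simps)
next
  \<comment> \<open>In dimension one no arc joins the directions, but the sphere is {e, -e}: maximum
    plus minimum of two values is their sum, and the error is zero.\<close>
  case False
  then have "DIM('a) = 1"
    using DIM_positive[where 'a = 'a] by linarith
  then obtain b :: 'a where b: "Basis = {b}"
    by (auto simp: card_1_singleton_iff)
  have rep: "y = (y \<bullet> b) *\<^sub>R b" for y :: 'a
    using euclidean_representation[of y] by (simp add: b)
  have nb: "norm b = 1" by (rule norm_Basis) (simp add: b)
  have abs1: "\<bar>y \<bullet> b\<bar> = 1" if "norm y = 1" for y :: 'a
    using that rep[of y] nb by (metis mult.right_neutral norm_scaleR)
  have pm: "y = e \<or> y = - e" if "norm y = 1" for y :: 'a
    using abs1[OF that] abs1[OF norm_e] rep[of y] rep[of e]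
    by (metis abs_eq_iff scaleR_minus_left)
  have sph: "sphere 0 1 = {e, - e}"
  proof (intro set_eqI iffI)
    fix y :: 'a assume "y \<in> sphere 0 1"
    then show "y \<in> {e, - e}" using pm[of y] by simp
  qed auto
  have "(SUP y\<in>sphere 0 1. Av \<epsilon> y) + (INF y\<in>sphere 0 1. Av \<epsilon> y) = Av \<epsilon> e + Av \<epsilon> (- e)"
    unfolding sph by (simp add: cSup_eq_Max cInf_eq_Min max_def min_def)
  then have "Ao s \<epsilon> \<phi> x = (Av \<epsilon> e + Av \<epsilon> (- e)) / 2"
    by (simp add: Ao_def Av_def)
  moreover have "0 \<le> s * \<epsilon> powr (2 * s) * E \<epsilon>" using E_nonneg[OF \<epsilon>] s_gt by simp
  ultimately show ?thesis by (simp only: diff_self abs_zero)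
qed

text \<open>An exact identity: the s (1 - s) in c_s turns the tail of the operator into 1 - s times
  the mean of the two averages minus \<phi> x. The nonlocal error thus comes from the choice of
  directions alone.\<close>

lemma tail_int_Lphi:
  assumes "0 < \<epsilon>"
  shows "\<epsilon> powr (2 * s) / cs s * tail_int s \<epsilon> (\<lambda>t. Lphi \<phi> x (t *\<^sub>R e) (t *\<^sub>R e))
    = (1 - s) * ((Av \<epsilon> e + Av \<epsilon> (- e)) / 2) - (1 - s) * \<phi> x"
proof -
  note i = ray_integrable[OF assms, of e] ray_integrable[OF assms, of "- e"]
  have j: "set_integrable lborel {\<epsilon><..} (\<lambda>t. 2 * \<phi> x * W t)"
    using W_Ioi(1)[OF assms] by simp
  have "(LINT t:{\<epsilon><..}|lborel. W t * Lphi \<phi> x (t *\<^sub>R e) (t *\<^sub>R e))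
      = (LINT t:{\<epsilon><..}|lborel. (W t * \<phi> (x + t *\<^sub>R e) + W t * \<phi> (x + t *\<^sub>R - e)) - 2 * \<phi> x * W t)"
    by (intro set_lebesgue_integral_cong) (auto simp: Lphi_def algebra_simps)
  also have "\<dots> = F \<epsilon> e + F \<epsilon> (- e) - 2 * \<phi> x * (\<epsilon> powr (- 2 * s) / (2 * s))"
    using set_integral_diff(2)[OF set_integral_add(1)[OF i] j] set_integral_add(2)[OF i] W_Ioi(2)[OF assms]
    by (simp add: F_def)
  finally have T: "tail_int s \<epsilon> (\<lambda>t. Lphi \<phi> x (t *\<^sub>R e) (t *\<^sub>R e))
      = Cs s * (F \<epsilon> e + F \<epsilon> (- e) - 2 * \<phi> x * (\<epsilon> powr (- 2 * s) / (2 * s)))"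
    using assms by (simp add: tail_int_eq)
  have 1: "\<epsilon> powr (2 * s) * \<epsilon> powr (- 2 * s) = 1"
    using assms by (simp add: powr_add[symmetric])
  have "P / (Cs s / (s * (1 - s))) * (Cs s * (X - 2 * f * (Q / (2 * s)))) = (1 - s) * (s * P * X) - (1 - s) * f * (P * Q)"
    for P Q X f :: real
    using Cs_pos s_gt s_lt by (simp add: field_simps)
  from this[of "\<epsilon> powr (2 * s)" "F \<epsilon> e + F \<epsilon> (- e)" "\<phi> x" "\<epsilon> powr (- 2 * s)"]
  show ?thesis
    unfolding Av_eq[OF assms] cs_def T 1 by (simp add: distrib_left mult_ac)
qed

section \<open>Assembling the estimate\<close>

theorem Aeps_estimate:
  assumes \<epsilon>: "0 < \<epsilon>" "\<epsilon> < \<eta>"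
  shows "\<bar>ereal (Aeps s \<epsilon> \<phi> x - \<phi> x) - ereal (\<epsilon> powr (2 * s) / cs s) * Ls s \<phi> x\<bar>
    \<le> ereal ((1 - s) * s * \<epsilon> powr (2 * s) * E \<epsilon>
        + s * \<epsilon> ^ 3 * (norm (H x))\<^sup>2 / (2 * norm (G x)) + s * \<epsilon>\<^sup>2 * D \<epsilon>)"
proof -
  let ?m = "\<epsilon> powr (2 - 2 * s) / (2 - 2 * s)"
  define q c T where "q = H x e \<bullet> e" and "c = \<epsilon> powr (2 * s) / cs s"
    and "T = tail_int s \<epsilon> (\<lambda>t. Lphi \<phi> x (t *\<^sub>R e) (t *\<^sub>R e))"
  define N where "N = \<epsilon> ^ 3 * (norm (H x))\<^sup>2 / (2 * norm (G x))"
  obtain J where J: "Ls s \<phi> x = ereal (J + T)" "\<bar>J - Cs s * q * ?m\<bar> \<le> Cs s * D \<epsilon> * ?m"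
    using Ls_eq[OF \<epsilon>] unfolding q_def T_def by blast
  have "0 < c"
    unfolding c_def cs_def using Cs_pos s_gt s_lt \<epsilon> by simp
  have "\<epsilon> powr (2 * s) * \<epsilon> powr (2 - 2 * s) = \<epsilon>\<^sup>2"
    using \<epsilon> by (simp add: powr_add[symmetric])
  \<comment> \<open>The normalized second moment over (0, \<epsilon>]. It equals the coefficient s
    \<epsilon>^2 / 2 that the Hessian receives from the ball term, so the two main parts
    cancel.\<close>
  then have cm: "c * Cs s * ?m = s * \<epsilon>\<^sup>2 / 2"
    unfolding c_def cs_def using Cs_pos s_gt s_lt by (simp add: field_simps)
  have "c * \<bar>J - Cs s * q * ?m\<bar> \<le> c * (Cs s * D \<epsilon> * ?m)"
    using J(2) \<open>0 < c\<close> by (intro mult_left_mono) auto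
  then have "\<bar>c * J - q * (c * Cs s * ?m)\<bar> \<le> D \<epsilon> * (c * Cs s * ?m)"
    using \<open>0 < c\<close> abs_mult[of c "J - Cs s * q * ?m"] by (simp add: right_diff_distrib mult_ac)
  then have cJ: "\<bar>c * J - q * (s * \<epsilon>\<^sup>2 / 2)\<bar> \<le> D \<epsilon> * (s * \<epsilon>\<^sup>2 / 2)"
    unfolding cm .
  have cT: "c * T = (1 - s) * ((Av \<epsilon> e + Av \<epsilon> (- e)) / 2) - (1 - s) * \<phi> x"
    unfolding c_def T_def by (rule tail_int_Lphi[OF \<epsilon>(1)])
  define S where "S = (SUP z\<in>ball x \<epsilon>. \<phi> z) + (INF z\<in>ball x \<epsilon>. \<phi> z)"
  \<comment> \<open>The first order terms \<epsilon> |G x| of the supremum and the infimum have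
    opposite signs and cancel in the sum.\<close>
  have "\<bar>S - 2 * \<phi> x - \<epsilon>\<^sup>2 * q\<bar> \<le> 2 * N + D \<epsilon> * \<epsilon>\<^sup>2"
    using sup_ball_estimate[OF \<epsilon>] inf_ball_estimate[OF \<epsilon>]
    unfolding S_def N_def[symmetric] q_def[symmetric] abs_le_iff by linarith
  then have "s / 2 * \<bar>S - 2 * \<phi> x - \<epsilon>\<^sup>2 * q\<bar> \<le> s / 2 * (2 * N + D \<epsilon> * \<epsilon>\<^sup>2)"
    using s_gt by (intro mult_left_mono) auto
  then have loc: "\<bar>s / 2 * S - s * \<phi> x - q * (s * \<epsilon>\<^sup>2 / 2)\<bar> \<le> s * N + D \<epsilon> * (s * \<epsilon>\<^sup>2 / 2)"
    using s_gt abs_mult[of "s / 2" "S - 2 * \<phi> x - \<epsilon>\<^sup>2 * q"] by (simp add: algebra_simps)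
  define \<Delta> where "\<Delta> = Ao s \<epsilon> \<phi> x - (Av \<epsilon> e + Av \<epsilon> (- e)) / 2"
  have "(1 - s) * \<bar>\<Delta>\<bar> \<le> (1 - s) * (s * \<epsilon> powr (2 * s) * E \<epsilon>)"
    using Ao_estimate[OF \<epsilon>] s_lt unfolding \<Delta>_def by (intro mult_left_mono) auto
  then have nonloc: "\<bar>(1 - s) * \<Delta>\<bar> \<le> (1 - s) * s * \<epsilon> powr (2 * s) * E \<epsilon>"
    using s_lt by (simp add: abs_mult mult.assoc)
  have "Aeps s \<epsilon> \<phi> x - \<phi> x - c * (J + T)
      = (1 - s) * \<Delta> + (s / 2 * S - s * \<phi> x - q * (s * \<epsilon>\<^sup>2 / 2)) - (c * J - q * (s * \<epsilon>\<^sup>2 / 2))"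
    unfolding Aeps_def S_def[symmetric] \<Delta>_def distrib_left[of c] cT by (simp add: algebra_simps)
  \<comment> \<open>\<open>D \<epsilon>\<close> enters twice with weight s \<epsilon>^2 / 2: from
    the ball, and from replacing J by its Taylor value.\<close>
  then have "\<bar>Aeps s \<epsilon> \<phi> x - \<phi> x - c * (J + T)\<bar>
      \<le> (1 - s) * s * \<epsilon> powr (2 * s) * E \<epsilon> + s * N + 2 * (D \<epsilon> * (s * \<epsilon>\<^sup>2 / 2))"
    using nonloc loc cJ by linarith
  \<comment> \<open>By \<open>J(1)\<close> the value of \<open>Ls\<close> is finite, so the extended
    real claim reduces to this real inequality.\<close>
  then show ?thesis
    unfolding J(1) c_def[symmetric] by (simp add: N_def mult_ac)
qed

end

theorem theorem1p2:
  fixes s :: real and \<phi> :: "'a::euclidean_space \<Rightarrow> real" and x :: 'a and \<eta> \<epsilon> :: real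
    and G :: "'a \<Rightarrow> 'a" and H :: "'a \<Rightarrow> 'a \<Rightarrow>\<^sub>L 'a"
  assumes s_gt: "1/2 < s" and s_lt: "s < 1"
    and eta_pos: "0 < \<eta>"
    and phi_bdd: "bounded (range \<phi>)"
    and phi_borel: "\<phi> \<in> borel_measurable borel"
    and grad: "\<forall>z\<in>cball x \<eta>. (\<phi> has_derivative (\<lambda>h. G z \<bullet> h)) (at z within cball x \<eta>)"
    and hess: "\<forall>z\<in>cball x \<eta>. (G has_derivative blinfun_apply (H z)) (at z within cball x \<eta>)"
    and hess_cont: "continuous_on (cball x \<eta>) H"
    and unif: "uniformly_continuous_on (- cball x \<eta>) \<phi>"
    and px_ne: "G x \<noteq> 0"
    and eps_pos: "0 < \<epsilon>" and eps_lt: "\<epsilon> < \<eta>"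
    and eps_hess: "\<epsilon> * norm (H x) \<le> norm (G x)"
  shows "\<bar>ereal (Aeps s \<epsilon> \<phi> x - \<phi> x) - ereal (\<epsilon> powr (2 * s) / cs s) * Ls s \<phi> x\<bar>
    \<le> ereal (
       2 * \<epsilon> powr (2 * s) *
         (2 * s * ((1/2) * (SUP y\<in>ball x \<eta>. norm (H y))) * (\<eta> powr (2 - 2 * s) - \<epsilon> powr (2 - 2 * s))
              * Acoef s ((1/2) * (SUP y\<in>ball x \<eta>. norm (H y))) (omega \<phi> x \<eta>) (norm (G x)) \<eta> \<epsilon>
          + (\<eta> powr (- 2 * s) / 2 + s * \<eta> powr (1 - 2 * s) / (2 * s - 1)) * (1 - s)
              * omega \<phi> x \<eta> (Acoef s ((1/2) * (SUP y\<in>ball x \<eta>. norm (H y))) (omega \<phi> x \<eta>) (norm (G x)) \<eta> \<epsilon>))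
       + 2 * s * \<epsilon> ^ 3 * (norm (H x))\<^sup>2 / norm (G x)
       + s * \<epsilon>\<^sup>2 * (SUP y\<in>ball x \<epsilon>. norm (H y - H x)))"
proof -
  interpret nonlocal_data s \<phi> x \<eta> G H
    by unfold_locales (use assms in auto)
  let ?W = "omega \<phi> x \<eta> (A \<epsilon>)"
  have n2: "2 * (1 - s) * near2 \<epsilon> = \<eta> powr (2 - 2 * s) - \<epsilon> powr (2 - 2 * s)"
    unfolding near2_def using s_lt by simp
  have fr: "s * far = \<eta> powr (- 2 * s) / 2 + s * \<eta> powr (1 - 2 * s) / (2 * s - 1)"
    unfolding far_def using s_gt by (simp add: distrib_left)
  have "(1 - s) * s * \<epsilon> powr (2 * s) * E \<epsilon>
      = 2 * \<epsilon> powr (2 * s) * (2 * s * ((1/2) * K) * (2 * (1 - s) * near2 \<epsilon>) * A \<epsilon> + s * far * (1 - s) * ?W)"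
    unfolding E_def by (simp add: algebra_simps)
  \<comment> \<open>Completing the square gave the constant 1/2, which is relaxed to the 2 of the
    theorem.\<close>
  moreover have "s * \<epsilon> ^ 3 * (norm (H x))\<^sup>2 / (2 * norm (G x)) \<le> 2 * s * \<epsilon> ^ 3 * (norm (H x))\<^sup>2 / norm (G x)"
  proof -
    have "u / (2 * p) \<le> 2 * u / p" if "0 \<le> u" "0 < p" for u p :: real
      using that by (simp add: field_simps)
    from this[of "s * \<epsilon> ^ 3 * (norm (H x))\<^sup>2" "norm (G x)"] show ?thesis
      using s_gt eps_pos px_ne by (simp add: mult.assoc)
  qed
  ultimately have "(1 - s) * s * \<epsilon> powr (2 * s) * E \<epsilon>
        + s * \<epsilon> ^ 3 * (norm (H x))\<^sup>2 / (2 * norm (G x)) + s * \<epsilon>\<^sup>2 * D \<epsilon>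
      \<le> 2 * \<epsilon> powr (2 * s) * (2 * s * ((1/2) * K) * (\<eta> powr (2 - 2 * s) - \<epsilon> powr (2 - 2 * s)) * A \<epsilon>
          + (\<eta> powr (- 2 * s) / 2 + s * \<eta> powr (1 - 2 * s) / (2 * s - 1)) * (1 - s) * ?W)
        + 2 * s * \<epsilon> ^ 3 * (norm (H x))\<^sup>2 / norm (G x) + s * \<epsilon>\<^sup>2 * D \<epsilon>"
    unfolding n2 fr by linarith
  then show ?thesis
    using Aeps_estimate[OF eps_pos eps_lt] unfolding A_def K_def D_def
    by (meson ereal_less_eq(3) order_trans)
qed

end
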